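(* Let $\mathbb F$ be an algebraically closed field and let $q\in\mathbb F$ be nonzero and not a root of unity. Pick an integer $d\ge 1$ and a nonzero $t\in\mathbb F$ that is not among $\{q^{d-2n+1}\}_{n=1}^d$. Then there exists an evaluation module $\mathbf V_d(t)$ for $\boxtimes_q$ with the following property: $\mathbf V_d(t)$ has a basis with respect to which the standard generators $x_{ij}$ are represented by the following matrices in ${\rm Mat}_{d+1}(\mathbb F)$: $$x_{01}: ZS_{q^{-1}}(t^{-1})Z,\quad x_{12}: E_q,\quad x_{23}: K_q,\quad x_{30}: ZG_{q^{-1}}(t)Z,$$ $$x_{02}: L_q(t),\quad x_{13}: (ZE_{q^{-1}}Z)^{-1},\quad x_{20}: (L_q(t))^{-1},\quad x_{31}: ZE_{q^{-1}}Z.$$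
   Context: Algebras are associative with 1. $[n]_q=(q^n-q^{-n})/(q-q^{-1})$ and $\mathbb Z_4=\mathbb Z/4\mathbb Z$. The $q$-tetrahedron algebra $\boxtimes_q$ is the $\mathbb F$-algebra with generators (called the standard generators) $\{x_{ij}\mid i,j\in\mathbb Z_4,\ j-i=1\text{ or }j-i=2\}$ and relations: (i) $x_{ij}x_{ji}=1$ if $j-i=2$; (ii) $\frac{qx_{ij}x_{jk}-q^{-1}x_{jk}x_{ij}}{q-q^{-1}}=1$ if $(j-i,k-j)$ is one of $(1,1),(1,2),(2,1)$; (iii) $x_{ij}^3x_{k\ell}-[3]_qx_{ij}^2x_{k\ell}x_{ij}+[3]_qx_{ij}x_{k\ell}x_{ij}^2-x_{k\ell}x_{ij}^3=0$ if $j-i=k-j=\ell-k=1$. Known fact: on a finite-dimensional irreducible $\boxtimes_q$-module $V$ there are $d\in\mathbb N$ (the diameter) and $\varepsilon\in\{1,-1\}$ (the type) such that each standard generator is diagonalizable with set of distinct eigenvalues $\{\varepsilon q^{d-2n}\mid 0\le n\le d\}$. If $V$ has type 1, the sequence of dimensions of the eigenspaces of $x_{ij}$ for eigenvalues $q^{d},q^{d-2},\dots,q^{-d}$ does not depend on $x_{ij}$; it is called the shape of $V$. The trivial $\boxtimes_q$-module is the one-dimensional module on which every standard generator acts as the identity. An evaluation module for $\boxtimes_q$ is a nontrivial finite-dimensional irreducible $\boxtimes_q$-module of type 1 and shape $(1,1,\dots,1)$ (so $d\ge1$ and $\dim V=d+1$). Matrices in ${\rm Mat}_{d+1}(\mathbb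 F)$ have rows and columns indexed by $0,\dots,d$; $M$ represents $A$ with respect to a basis $\{v_n\}_{n=0}^d$ when $Av_n=\sum_i M_{in}v_i$. Entries not mentioned below are $0$. A subscript $q^{-1}$ means that $q$ is replaced by $q^{-1}$ in the definition (and similarly $t^{-1}$ as argument). - $Z$: $(i,j)$-entry $\delta_{i+j,d}$. - $K_q$: diagonal, $(i,i)$-entry $q^{d-2i}$. - $E_q$: $(i,i)$-entry $q^{2i-d}$; $(i-1,i)$-entry $q^d-q^{2i-2-d}$. - $G_q(t)$: $(i,i)$-entry $q^{2i-d}$; $(i-1,i)$-entry $(q^d-q^{2i-2-d})(1-tq^{d-2i+1})$. - $L_q(t)$: $(i,i)$-entry $q^{2i-d}$; $(i-1,i)$-entry $(q^d-q^{2i-2-d})(1-tq^{d-2i+1})^{-1}$. - $S_q(t)$: $(i-1,i)$-entry $(q^d-q^{2i-d-2})(1-tq^{2i-d-1})$; $(i,i-1)$-entry $(q^{2i-d}-q^{-d})q^{2i-d-1}t$; $(i,i)$-entry $q^d-(q^{2i-d}-q^{-d})q^{2i-d-1}t-(q^d-q^{2i-d})(1-tq^{2i-d+1})$. *)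

theory Defs
  imports
    "Jordan_Normal_Form.VS_Connect"
    "HOL-Algebra.QuotRing"
    "HOL-Library.Poly_Mapping"
    "HOL-Library.Numeral_Type"
begin

section \<open>Free algebras\<close>

text \<open>The free monoid is written additively, because the convolution product of
  \<^theory>\<open>HOL-Library.Poly_Mapping\<close> expects an additive monoid of exponents. The free algebra
  on \<open>'g\<close> over \<open>'f\<close> is its monoid algebra.\<close>

datatype 'g free_word = Word (letters: "'g list")

instantiation free_word :: (type) monoid_add
begin

definition zero_free_word :: "'a free_word" where
  "0 = Word []"

definition plus_free_word :: "'a free_word \<Rightarrow> 'a free_word \<Rightarrow> 'a free_word" where
  "u + v = Word (letters u @ letters v)"

instance
  by standard (simp_all add: zero_free_word_def plus_free_word_def)

end

type_synonym ('g, 'f) free_algebra = "'g free_word \<Rightarrow>\<^sub>0 'f"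

definition free_gen :: "'g \<Rightarrow> ('g, 'f::ring_1) free_algebra" where
  "free_gen g = Poly_Mapping.single (Word [g]) 1"

definition free_scalar :: "'f \<Rightarrow> ('g, 'f::ring_1) free_algebra" where
  "free_scalar c = Poly_Mapping.single 0 c"


section \<open>The q-tetrahedron algebra\<close>

text \<open>The type \<^typ>\<open>4\<close> is the ring of integers modulo 4.\<close>

typedef tet_index = "{(i :: 4, j :: 4). j - i = 1 \<or> j - i = 2}"
  by (rule exI[of _ "(0, 1)"]) simp

text \<open>Only meaningful if \<open>j - i = 1\<close> or \<open>j - i = 2\<close>.\<close>

definition free_x :: "4 \<Rightarrow> 4 \<Rightarrow> (tet_index, 'f::field) free_algebra" where
  "free_x i j = free_gen (Abs_tet_index (i, j))"

definition q_number :: "nat \<Rightarrow> 'f::field \<Rightarrow> 'f" where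
  "q_number n q = (q ^ n - inverse q ^ n) / (q - inverse q)"

text \<open>A relation \<open>lhs = rhs\<close> is encoded by the element \<open>lhs - rhs\<close>.\<close>

definition tet_relators :: "'f::field \<Rightarrow> (tet_index, 'f) free_algebra set" where
  "tet_relators q =
     {free_x i j * free_x j i - 1 | i j. j - i = 2}
   \<union> {free_scalar (1 / (q - inverse q)) *
        (free_scalar q * free_x i j * free_x j k
         - free_scalar (inverse q) * free_x j k * free_x i j) - 1
      | i j k. (j - i, k - j) \<in> {(1, 1), (1, 2), (2, 1)}}
   \<union> {free_x i j ^ 3 * free_x k l
        - free_scalar (q_number 3 q) * free_x i j ^ 2 * free_x k l * free_x i j
        + free_scalar (q_number 3 q) * free_x i j * free_x k l * free_x i j ^ 2
        - free_x k l * free_x i j ^ 3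
      | i j k l. j - i = 1 \<and> k - j = 1 \<and> l - k = 1}"

definition tet_ideal :: "'f::field \<Rightarrow> (tet_index, 'f) free_algebra set" where
  "tet_ideal q = Idl\<^bsub>class_ring\<^esub> (tet_relators q)"

definition tet_algebra :: "'f::field \<Rightarrow> (tet_index, 'f) free_algebra set ring" where
  "tet_algebra q = class_ring Quot (tet_ideal q)"

definition tet_scalar :: "'f::field \<Rightarrow> 'f \<Rightarrow> (tet_index, 'f) free_algebra set" where
  "tet_scalar q c = tet_ideal q +>\<^bsub>class_ring\<^esub> free_scalar c"

definition tet_x :: "'f::field \<Rightarrow> 4 \<Rightarrow> 4 \<Rightarrow> (tet_index, 'f) free_algebra set" where
  "tet_x q i j = tet_ideal q +>\<^bsub>class_ring\<^esub> free_x i j"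


section \<open>Modules over an algebra\<close>

text \<open>An algebra over the field \<open>'f\<close> is given by a ring \<open>A\<close> and its structure map
  \<open>\<eta> : 'f \<rightarrow> A\<close>; a module is a vector space \<open>V\<close> with a unital algebra homomorphism \<open>\<rho>\<close>
  from \<open>A\<close> to the endomorphisms of \<open>V\<close>.\<close>

locale algebra_module =
  fixes A :: "'a ring" and \<eta> :: "'f::field \<Rightarrow> 'a"
    and V :: "('f, 'v) module" and \<rho> :: "'a \<Rightarrow> 'v \<Rightarrow> 'v"
  assumes vectorspace: "vectorspace class_ring V"
    and linear: "a \<in> carrier A \<Longrightarrow> linear_map class_ring V V (\<rho> a)"
    and add: "\<lbrakk>a \<in> carrier A; b \<in> carrier A; v \<in> carrier V\<rbrakk>
                \<Longrightarrow> \<rho> (a \<oplus>\<^bsub>A\<^esub> b) v = \<rho> a v \<oplus>\<^bsub>V\<^esub> \<rho> b v"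
    and mult: "\<lbrakk>a \<in> carrier A; b \<in> carrier A; v \<in> carrier V\<rbrakk>
                \<Longrightarrow> \<rho> (a \<otimes>\<^bsub>A\<^esub> b) v = \<rho> a (\<rho> b v)"
    and one: "v \<in> carrier V \<Longrightarrow> \<rho> \<one>\<^bsub>A\<^esub> v = v"
    and scalar: "v \<in> carrier V \<Longrightarrow> \<rho> (\<eta> c) v = c \<odot>\<^bsub>V\<^esub> v"

definition irreducible_module ::
    "'a ring \<Rightarrow> ('f::field, 'v) module \<Rightarrow> ('a \<Rightarrow> 'v \<Rightarrow> 'v) \<Rightarrow> bool" where
  "irreducible_module A V \<rho> \<longleftrightarrow>
     carrier V \<noteq> {\<zero>\<^bsub>V\<^esub>} \<and>
     (\<forall>W. VectorSpace.subspace class_ring W V \<and> (\<forall>a\<in>carrier A. \<rho> a ` W \<subseteq> W)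
        \<longrightarrow> W = {\<zero>\<^bsub>V\<^esub>} \<or> W = carrier V)"

definition lin_eigenspace :: "('f::field, 'v) module \<Rightarrow> ('v \<Rightarrow> 'v) \<Rightarrow> 'f \<Rightarrow> 'v set" where
  "lin_eigenspace V T \<mu> = {v \<in> carrier V. T v = \<mu> \<odot>\<^bsub>V\<^esub> v}"

definition lin_eigenvalues :: "('f::field, 'v) module \<Rightarrow> ('v \<Rightarrow> 'v) \<Rightarrow> 'f set" where
  "lin_eigenvalues V T = {\<mu>. \<exists>v\<in>lin_eigenspace V T \<mu>. v \<noteq> \<zero>\<^bsub>V\<^esub>}"

definition lin_diagonalizable :: "('f::field, 'v) module \<Rightarrow> ('v \<Rightarrow> 'v) \<Rightarrow> bool" where
  "lin_diagonalizable V T \<longleftrightarrow>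
     (\<exists>B. vectorspace.basis class_ring V B \<and> (\<forall>v\<in>B. \<exists>\<mu>. v \<in> lin_eigenspace V T \<mu>))"


section \<open>Evaluation modules for the q-tetrahedron algebra\<close>

type_synonym ('f, 'v) tet_action = "(tet_index, 'f) free_algebra set \<Rightarrow> 'v \<Rightarrow> 'v"

definition fin_dim_irreducible_tet_module ::
    "'f::field \<Rightarrow> ('f, 'v) module \<Rightarrow> ('f, 'v) tet_action \<Rightarrow> bool" where
  "fin_dim_irreducible_tet_module q V \<rho> \<longleftrightarrow>
     algebra_module (tet_algebra q) (tet_scalar q) V \<rho> \<and>
     vectorspace.fin_dim class_ring V \<and>
     irreducible_module (tet_algebra q) V \<rho>"

definition trivial_tet_module ::
    "'f::field \<Rightarrow> ('f, 'v) module \<Rightarrow> ('f, 'v) tet_action \<Rightarrow> bool" where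
  "trivial_tet_module q V \<rho> \<longleftrightarrow>
     algebra_module (tet_algebra q) (tet_scalar q) V \<rho> \<and>
     vectorspace.dim class_ring V = 1 \<and>
     (\<forall>i j. j - i = 1 \<or> j - i = 2 \<longrightarrow> (\<forall>v\<in>carrier V. \<rho> (tet_x q i j) v = v))"

definition has_diameter_and_type ::
    "'f::field \<Rightarrow> ('f, 'v) module \<Rightarrow> ('f, 'v) tet_action \<Rightarrow> nat \<Rightarrow> 'f \<Rightarrow> bool" where
  "has_diameter_and_type q V \<rho> d \<epsilon> \<longleftrightarrow>
     \<epsilon> \<in> {1, -1} \<and>
     (\<forall>i j. j - i = 1 \<or> j - i = 2 \<longrightarrow>
        lin_diagonalizable V (\<rho> (tet_x q i j)) \<and>
        lin_eigenvalues V (\<rho> (tet_x q i j)) = {\<epsilon> * q powi (int d - 2 * int n) | n. n \<le> d})"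

text \<open>The shape is defined for modules of type 1 only.\<close>

definition has_shape ::
    "'f::field \<Rightarrow> ('f, 'v) module \<Rightarrow> ('f, 'v) tet_action \<Rightarrow> nat list \<Rightarrow> bool" where
  "has_shape q V \<rho> ds \<longleftrightarrow>
     (\<exists>d. has_diameter_and_type q V \<rho> d 1 \<and> length ds = d + 1 \<and>
        (\<forall>i j. j - i = 1 \<or> j - i = 2 \<longrightarrow>
           (\<forall>n\<le>d. vectorspace.dim class_ring
              (V\<lparr>carrier := lin_eigenspace V (\<rho> (tet_x q i j)) (q powi (int d - 2 * int n))\<rparr>)
              = ds ! n)))"

definition evaluation_module ::
    "'f::field \<Rightarrow> ('f, 'v) module \<Rightarrow> ('f, 'v) tet_action \<Rightarrow> bool" where
  "evaluation_module q V \<rho> \<longleftrightarrow>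
     fin_dim_irreducible_tet_module q V \<rho> \<and>
     \<not> trivial_tet_module q V \<rho> \<and>
     (\<exists>d. has_diameter_and_type q V \<rho> d 1) \<and>
     (\<exists>m. has_shape q V \<rho> (replicate m 1))"


section \<open>Matrices\<close>

text \<open>Rows and columns are indexed by \<open>0, \<dots>, d\<close>; \<open>r\<close> is the row and \<open>c\<close> the column. Where
  the usual description gives the entries as \<open>(i-1, i)\<close>, \<open>i\<close> is the column \<open>c\<close>; for
  \<open>(i, i-1)\<close>, it is the row \<open>r\<close>.\<close>

definition Z_mat :: "nat \<Rightarrow> 'f::field mat" where
  "Z_mat d = mat (d + 1) (d + 1) (\<lambda>(r, c). if r + c = d then 1 else 0)"

definition K_mat :: "nat \<Rightarrow> 'f::field \<Rightarrow> 'f mat" where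
  "K_mat d q = mat (d + 1) (d + 1) (\<lambda>(r, c). if r = c then q powi (int d - 2 * int r) else 0)"

definition E_mat :: "nat \<Rightarrow> 'f::field \<Rightarrow> 'f mat" where
  "E_mat d q = mat (d + 1) (d + 1) (\<lambda>(r, c).
     if r = c then q powi (2 * int r - int d)
     else if r + 1 = c then q powi int d - q powi (2 * int c - 2 - int d)
     else 0)"

definition G_mat :: "nat \<Rightarrow> 'f::field \<Rightarrow> 'f \<Rightarrow> 'f mat" where
  "G_mat d q t = mat (d + 1) (d + 1) (\<lambda>(r, c).
     if r = c then q powi (2 * int r - int d)
     else if r + 1 = c then
       (q powi int d - q powi (2 * int c - 2 - int d)) * (1 - t * q powi (int d - 2 * int c + 1))
     else 0)"

definition L_mat :: "nat \<Rightarrow> 'f::field \<Rightarrow> 'f \<Rightarrow> 'f mat" where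
  "L_mat d q t = mat (d + 1) (d + 1) (\<lambda>(r, c).
     if r = c then q powi (2 * int r - int d)
     else if r + 1 = c then
       (q powi int d - q powi (2 * int c - 2 - int d))
         * inverse (1 - t * q powi (int d - 2 * int c + 1))
     else 0)"

definition S_mat :: "nat \<Rightarrow> 'f::field \<Rightarrow> 'f \<Rightarrow> 'f mat" where
  "S_mat d q t = mat (d + 1) (d + 1) (\<lambda>(r, c).
     if r + 1 = c then
       (q powi int d - q powi (2 * int c - int d - 2)) * (1 - t * q powi (2 * int c - int d - 1))
     else if r = c + 1 then
       (q powi (2 * int r - int d) - q powi (- int d)) * q powi (2 * int r - int d - 1) * t
     else if r = c then
       q powi int d
         - (q powi (2 * int r - int d) - q powi (- int d)) * q powi (2 * int r - int d - 1) * t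
         - (q powi int d - q powi (2 * int r - int d)) * (1 - t * q powi (2 * int r - int d + 1))
     else 0)"

abbreviation mat_inv :: "nat \<Rightarrow> 'f::field mat \<Rightarrow> 'f mat" where
  "mat_inv d M \<equiv> inv\<^bsub>ring_mat TYPE('f) (d + 1) ()\<^esub> M"

definition indexed_basis :: "nat \<Rightarrow> ('f::field, 'v) module \<Rightarrow> (nat \<Rightarrow> 'v) \<Rightarrow> bool" where
  "indexed_basis d V v \<longleftrightarrow> inj_on v {0..d} \<and> vectorspace.basis class_ring V (v ` {0..d})"

definition represents ::
    "nat \<Rightarrow> ('f::field, 'v) module \<Rightarrow> (nat \<Rightarrow> 'v) \<Rightarrow> 'f mat \<Rightarrow> ('v \<Rightarrow> 'v) \<Rightarrow> bool" where
  "represents d V v M T \<longleftrightarrow>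
     M \<in> carrier_mat (d + 1) (d + 1) \<and>
     (\<forall>n\<in>{0..d}. T (v n) = (\<Oplus>\<^bsub>V\<^esub>i\<in>{0..d}. M $$ (i, n) \<odot>\<^bsub>V\<^esub> v i))"

end

theory Submission
  imports Defs "Jordan_Normal_Form.Char_Poly"
begin

text \<open>A module over a finitely presented algebra is a choice of operators that satisfy the
  relations, so the eight prescribed matrices define \<open>V\<^sub>d(t)\<close> on the column vectors of length
  \<open>d + 1\<close> as soon as they satisfy the relations of \<open>\<boxtimes>\<^sub>q\<close> (\<open>algebra_module_act\<close>). Below, the
  matrix of \<open>x\<^sub>i\<^sub>j\<close> is called \<open>xij\<close>.

  The matrices \<open>x01\<close>, \<open>x12\<close>, \<open>x23\<close>, \<open>x30\<close>, \<open>x02\<close>, \<open>x31\<close> are tridiagonal, and a quadratic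
  relation between tridiagonal matrices amounts to five scalar identities, one for each band of the
  product (\<open>tri_relationI\<close>). With \<open>\<alpha> = q\<^sup>d\<close> and \<open>\<beta> i = q\<^sup>2\<^sup>i\<close> these are identities between rational
  functions of \<open>q\<close>, \<open>t\<close>, \<open>\<alpha>\<close>, \<open>\<beta> i\<close>. The remaining generators \<open>x13\<close>, \<open>x20\<close> are inverses of
  tridiagonal matrices, in general not tridiagonal themselves; a relation that involves \<open>x13 = x31\<inverse>\<close> is multiplied by \<open>x31\<close>
  from both sides, which turns the constant on its right into \<open>x31\<^sup>2\<close>, and likewise for \<open>x20\<close>
  (\<open>qcomm_inverse\<close>).

  The cubic relations need no computation with products of four matrices. On this module
  \<open>x30 x12 - x12 x30 = t (q - q\<inverse>) (x01 - x23)\<close> and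
  \<open>x01 x23 - x23 x01 = t\<inverse> (q - q\<inverse>) (x12 - x30)\<close>. In terms of left and right multiplication by
  \<open>A = x\<^sub>i\<^sub>j\<close> the cubic expression is \<open>(L - R) (L - q\<^sup>2 R) (L - q\<^sup>-\<^sup>2 R)\<close>. The first factor sends the
  opposite generator to a multiple of the difference of the two neighbours of \<open>A\<close> in the cycle
  \<open>x01, x12, x23, x30\<close>; by the quadratic relations, the other two factors send both neighbours to
  the same multiple of \<open>A\<close> (\<open>q_serre_of_commutator\<close>).

  Every generator has the \<open>d + 1\<close> distinct eigenvalues \<open>q\<^sup>d, q\<^sup>d\<^sup>-\<^sup>2, \<dots>, q\<^sup>-\<^sup>d\<close>, which gives
  diagonalizability, type 1 and shape \<open>(1, \<dots>, 1)\<close> at once. For the triangular matrices and their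
  inverses they are read off the diagonal. For \<open>x01\<close> they come from its relation with \<open>x30\<close>, which
  forces \<open>x01\<close> to be triangular in an eigenbasis of \<open>x30\<close> (\<open>simple_spectrum_raising\<close>).

  The module is irreducible: \<open>x23\<close> is diagonal with distinct entries, so a nonzero submodule contains
  a vector of the standard basis, and the nonzero off-diagonal entries of \<open>x31\<close> and \<open>x12\<close> lead from
  there to all the others.\<close>


section \<open>Evaluation of the free algebra on matrices\<close>

lemma smult_one: "1 \<cdot>\<^sub>m M = (M :: 'a::field mat)"
  by (rule eq_matI) simp_all

lemma smult_smult: "a \<cdot>\<^sub>m (b \<cdot>\<^sub>m M) = (a * b) \<cdot>\<^sub>m (M :: 'a::field mat)"
  by (rule eq_matI) simp_all

lemma smult_one_mult_vec:
  fixes v :: "'a::field vec"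
  assumes "v \<in> carrier_vec n"
  shows "(c \<cdot>\<^sub>m 1\<^sub>m n) *\<^sub>v v = c \<cdot>\<^sub>v v"
proof (rule eq_vecI)
  fix i assume "i < dim_vec (c \<cdot>\<^sub>v v)"
  then have i: "i < n" using assms by simp
  have "c * (if j = i then 1 else 0) * v $ j = (if j = i then c * v $ i else 0)" for j by simp
  then show "((c \<cdot>\<^sub>m 1\<^sub>m n) *\<^sub>v v) $ i = (c \<cdot>\<^sub>v v) $ i"
    using i assms by (simp add: scalar_prod_def)
qed (use assms in simp_all)

definition word_mat :: "nat \<Rightarrow> ('g \<Rightarrow> 'a::field mat) \<Rightarrow> 'g free_word \<Rightarrow> 'a mat" where
  "word_mat n Y w = foldr (\<lambda>g M. Y g * M) (letters w) (1\<^sub>m n)"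

text \<open>The substitution homomorphism of the free algebra is given entry by entry, because the
  matrices of all sizes share one type, which is not an additive monoid; so \<^const>\<open>sum\<close> does not
  apply to matrices.\<close>

definition eval_mat :: "nat \<Rightarrow> ('g \<Rightarrow> 'a::field mat) \<Rightarrow> ('g, 'a) free_algebra \<Rightarrow> 'a mat" where
  "eval_mat n Y p = mat n n (\<lambda>(i, j).
     \<Sum>w\<in>Poly_Mapping.keys p. Poly_Mapping.lookup p w * word_mat n Y w $$ (i, j))"

lemma eval_mat_carrier [simp]: "eval_mat n Y p \<in> carrier_mat n n"
  by (simp add: eval_mat_def)

lemma eval_mat_index:
  assumes "finite S" "Poly_Mapping.keys p \<subseteq> S" "i < n" "j < n"
  shows "eval_mat n Y p $$ (i, j) = (\<Sum>w\<in>S. Poly_Mapping.lookup p w * word_mat n Y w $$ (i, j))"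
proof -
  have "(\<Sum>w\<in>Poly_Mapping.keys p. Poly_Mapping.lookup p w * word_mat n Y w $$ (i, j))
    = (\<Sum>w\<in>S. Poly_Mapping.lookup p w * word_mat n Y w $$ (i, j))"
    by (rule sum.mono_neutral_left[OF assms(1,2)]) (auto simp: in_keys_iff)
  then show ?thesis using assms(3,4) by (simp add: eval_mat_def)
qed

lemma eval_mat_add: "eval_mat n Y (p + r) = eval_mat n Y p + eval_mat n Y r"
proof (rule eq_matI)
  fix i j assume "i < dim_row (eval_mat n Y p + eval_mat n Y r)" "j < dim_col (eval_mat n Y p + eval_mat n Y r)"
  then have ij: "i < n" "j < n" by (simp_all add: eval_mat_def)
  let ?S = "Poly_Mapping.keys p \<union> Poly_Mapping.keys r"
  have "eval_mat n Y (p + r) $$ (i, j) = eval_mat n Y p $$ (i, j) + eval_mat n Y r $$ (i, j)"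
    using ij Poly_Mapping.keys_add[of p r]
    by (simp add: eval_mat_index[where S = ?S] lookup_add distrib_right sum.distrib)
  then show "eval_mat n Y (p + r) $$ (i, j) = (eval_mat n Y p + eval_mat n Y r) $$ (i, j)"
    using ij by (simp add: eval_mat_def)
qed (simp_all add: eval_mat_def)

lemma eval_mat_zero: "eval_mat n Y 0 = 0\<^sub>m n n"
  by (rule eq_matI) (simp_all add: eval_mat_def)

text \<open>Both sides of \<open>f (p * r) = f p * f r\<close> are biadditive, so with this rule multiplicativity has
  to be checked on monomials only.\<close>

lemma poly_mapping_additive_induct:
  assumes zero: "P 0" and single: "\<And>k c. P (Poly_Mapping.single k c)"
    and add: "\<And>p r. P p \<Longrightarrow> P r \<Longrightarrow> P (p + r)"
  shows "P (f :: 'a \<Rightarrow>\<^sub>0 'b::comm_monoid_add)"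
proof (induction f rule: update_induct)
  case (update f a b)
  have "Poly_Mapping.update a b f = f + Poly_Mapping.single a b"
    using update(1) by (intro poly_mapping_eqI) (auto simp: lookup_update lookup_add lookup_single in_keys_iff when_def)
  then show ?case using add[OF update(3) single] by simp
qed (rule zero)

context
  fixes n :: nat and Y :: "'g \<Rightarrow> 'a::field mat"
  assumes Y: "\<And>g. Y g \<in> carrier_mat n n"
begin

lemma word_mat_carrier [simp]: "word_mat n Y w \<in> carrier_mat n n"
proof -
  have "foldr (\<lambda>g M. Y g * M) gs (1\<^sub>m n) \<in> carrier_mat n n" for gs
    using Y by (induction gs) (auto intro: mult_carrier_mat)
  then show ?thesis by (simp add: word_mat_def)
qed

lemma word_mat_dim [simp]: "dim_row (word_mat n Y w) = n" "dim_col (word_mat n Y w) = n"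
  using carrier_matD[OF word_mat_carrier[of w]] by blast+

lemma word_mat_add: "word_mat n Y (u + v) = word_mat n Y u * word_mat n Y v"
proof -
  have "foldr (\<lambda>g M. Y g * M) (gs @ hs) (1\<^sub>m n)
    = foldr (\<lambda>g M. Y g * M) gs (1\<^sub>m n) * foldr (\<lambda>g M. Y g * M) hs (1\<^sub>m n)" for gs hs
  proof (induction gs)
    case Nil
    show ?case using word_mat_carrier[of "Word hs"] by (simp add: word_mat_def)
  next
    case (Cons g gs)
    then show ?case using word_mat_carrier[of "Word hs"] word_mat_carrier[of "Word gs"] Y[of g]
      by (simp add: word_mat_def assoc_mult_mat[of _ n n _ n _ n])
  qed
  then show ?thesis by (simp add: word_mat_def plus_free_word_def)
qed

lemma eval_mat_single: "eval_mat n Y (Poly_Mapping.single w c) = c \<cdot>\<^sub>m word_mat n Y w"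
proof (rule eq_matI)
  fix i j assume "i < dim_row (c \<cdot>\<^sub>m word_mat n Y w)" "j < dim_col (c \<cdot>\<^sub>m word_mat n Y w)"
  then have "i < n" "j < n" by simp_all
  then show "eval_mat n Y (Poly_Mapping.single w c) $$ (i, j) = (c \<cdot>\<^sub>m word_mat n Y w) $$ (i, j)"
    by (simp add: eval_mat_index[where S = "{w}"])
qed (simp_all add: eval_mat_def)

lemma eval_mat_mult: "eval_mat n Y (p * r) = eval_mat n Y p * eval_mat n Y r"
proof (induction p rule: poly_mapping_additive_induct)
  case 1
  show ?case using left_mult_zero_mat[OF eval_mat_carrier[of n Y r]] by (simp add: eval_mat_zero)
next
  case (2 u a)
  show ?case
  proof (induction r rule: poly_mapping_additive_induct)
    case 1
    show ?case
      using right_mult_zero_mat[OF eval_mat_carrier[of n Y "Poly_Mapping.single u a"], of n]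
      by (simp add: eval_mat_zero)
  next
    case (2 v b)
    show ?case
      by (simp add: mult_single eval_mat_single word_mat_add
        mult_smult_distrib[OF smult_carrier_mat[OF word_mat_carrier] word_mat_carrier]
        mult_smult_assoc_mat[OF word_mat_carrier word_mat_carrier] smult_smult mult.commute)
  next
    case (3 p r)
    then show ?case
      by (simp add: distrib_left eval_mat_add mult_add_distrib_mat[OF eval_mat_carrier eval_mat_carrier eval_mat_carrier])
  qed
next
  case (3 p r')
  then show ?case
    by (simp add: distrib_right eval_mat_add add_mult_distrib_mat[OF eval_mat_carrier eval_mat_carrier eval_mat_carrier])
qed

lemma eval_mat_scalar: "eval_mat n Y (free_scalar c) = c \<cdot>\<^sub>m 1\<^sub>m n"
  by (simp add: free_scalar_def eval_mat_single word_mat_def zero_free_word_def)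

lemma eval_mat_one: "eval_mat n Y 1 = 1\<^sub>m n"
  using eval_mat_scalar[of 1] smult_one[of "1\<^sub>m n"] by (simp add: free_scalar_def)

lemma eval_mat_gen: "eval_mat n Y (free_gen g) = Y g"
  using right_mult_one_mat[OF Y[of g]] smult_one[of "Y g"]
  by (simp add: free_gen_def eval_mat_single word_mat_def)

lemma eval_mat_minus: "eval_mat n Y (p - r) = eval_mat n Y p - eval_mat n Y r"
proof (rule eq_matI)
  fix i j assume "i < dim_row (eval_mat n Y p - eval_mat n Y r)" "j < dim_col (eval_mat n Y p - eval_mat n Y r)"
  then have ij: "i < n" "j < n" by (simp_all add: eval_mat_def)
  have "eval_mat n Y p $$ (i, j) = (eval_mat n Y (p - r) + eval_mat n Y r) $$ (i, j)"
    unfolding eval_mat_add[symmetric] by simp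
  then show "eval_mat n Y (p - r) $$ (i, j) = (eval_mat n Y p - eval_mat n Y r) $$ (i, j)"
    using ij by (simp add: eval_mat_def)
qed (simp_all add: eval_mat_def)

lemma eval_mat_ring_hom: "ring_hom_ring class_ring (ring_mat TYPE('a) n ()) (eval_mat n Y)"
  by (rule ring_hom_ringI2[OF class_ring.ring_axioms ring_mat])
    (auto intro!: ring_hom_memI simp: ring_mat_simps eval_mat_add eval_mat_mult eval_mat_one)

end

section \<open>Modules from matrices that satisfy the relations\<close>

lemma exhaust_4:
  fixes i :: 4
  shows "i = 0 \<or> i = 1 \<or> i = 2 \<or> i = 3"
proof (cases i)
  case (of_int z)
  then have "z = 0 \<or> z = 1 \<or> z = 2 \<or> z = 3" by auto
  then show ?thesis using of_int(1) by auto
qed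

definition qcomm :: "'a::field \<Rightarrow> 'a mat \<Rightarrow> 'a mat \<Rightarrow> 'a mat" where
  "qcomm q M N = q \<cdot>\<^sub>m (M * N) - inverse q \<cdot>\<^sub>m (N * M)"

locale tet_matrices =
  fixes n :: nat and q :: "'f::field" and X :: "4 \<Rightarrow> 4 \<Rightarrow> 'f mat"
  assumes X_carrier: "X i j \<in> carrier_mat n n"
    and q_diff: "q - inverse q \<noteq> 0"
    and X_inverse: "j - i = 2 \<Longrightarrow> X i j * X j i = 1\<^sub>m n"
    and X_qcomm: "(j - i, k - j) \<in> {(1, 1), (1, 2), (2, 1)} \<Longrightarrow>
      qcomm q (X i j) (X j k) = (q - inverse q) \<cdot>\<^sub>m 1\<^sub>m n"
    and X_serre: "j - i = 1 \<Longrightarrow> k - j = 1 \<Longrightarrow> l - k = 1 \<Longrightarrow>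
      X i j * X i j * X i j * X k l
      - q_number 3 q \<cdot>\<^sub>m (X i j * X i j * X k l * X i j)
      + q_number 3 q \<cdot>\<^sub>m (X i j * X k l * X i j * X i j)
      - X k l * X i j * X i j * X i j = 0\<^sub>m n n"
begin

definition gen :: "tet_index \<Rightarrow> 'f mat" where
  "gen g = X (fst (Rep_tet_index g)) (snd (Rep_tet_index g))"

lemma gen_carrier: "gen g \<in> carrier_mat n n"
  by (simp add: gen_def X_carrier)

abbreviation ev :: "(tet_index, 'f) free_algebra \<Rightarrow> 'f mat" where "ev \<equiv> eval_mat n gen"

lemma ev_free_x: "j - i = 1 \<or> j - i = 2 \<Longrightarrow> ev (free_x i j) = X i j"
  by (simp add: free_x_def eval_mat_gen[OF gen_carrier] gen_def Abs_tet_index_inverse)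

lemmas ev_simps = eval_mat_minus[OF gen_carrier] eval_mat_add eval_mat_mult[OF gen_carrier]
  eval_mat_one[OF gen_carrier] eval_mat_scalar[OF gen_carrier]

lemma smult_one_mult: "A \<in> carrier_mat n n \<Longrightarrow> (c \<cdot>\<^sub>m 1\<^sub>m n) * A = c \<cdot>\<^sub>m (A :: 'f mat)"
  by (simp add: mult_smult_assoc_mat[of _ n n _ n])

lemma opposite_index: "j - i = (2::4) \<Longrightarrow> i - j = 2"
proof -
  assume "j - i = 2"
  then have "i - j = - (2::4)" by (metis minus_diff_eq)
  then show ?thesis by simp
qed

lemma ev_relator:
  assumes "r \<in> tet_relators q"
  shows "ev r = 0\<^sub>m n n"
  using assms unfolding tet_relators_def
proof (elim UnE CollectE exE conjE)
  fix i j :: 4 assume r: "r = free_x i j * free_x j i - 1" and ij: "j - i = 2"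
  then have "ev r = X i j * X j i - 1\<^sub>m n"
    by (simp add: ev_simps ev_free_x opposite_index)
  then show ?thesis using X_inverse[OF ij] by simp
next
  fix i j k :: 4
  assume r: "r = free_scalar (1 / (q - inverse q)) *
        (free_scalar q * free_x i j * free_x j k
         - free_scalar (inverse q) * free_x j k * free_x i j) - 1"
    and ijk: "(j - i, k - j) \<in> {(1, 1), (1, 2), (2, 1)}"
  have e: "ev (free_x i j) = X i j" "ev (free_x j k) = X j k"
    using ijk by (auto intro: ev_free_x)
  have "ev r = (1 / (q - inverse q) \<cdot>\<^sub>m 1\<^sub>m n) * qcomm q (X i j) (X j k) - 1\<^sub>m n"
    unfolding r ev_simps e qcomm_def
    using X_carrier by (simp add: smult_one_mult mult_smult_assoc_mat[of _ n n _ n] left_mult_one_mat[OF X_carrier])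
  also have "\<dots> = 0\<^sub>m n n"
    unfolding X_qcomm[OF ijk] using q_diff by (simp add: smult_one_mult smult_smult smult_one)
  finally show ?thesis .
next
  fix i j k l :: 4
  assume r: "r = free_x i j ^ 3 * free_x k l
        - free_scalar (q_number 3 q) * free_x i j ^ 2 * free_x k l * free_x i j
        + free_scalar (q_number 3 q) * free_x i j * free_x k l * free_x i j ^ 2
        - free_x k l * free_x i j ^ 3"
    and ijkl: "j - i = 1" "k - j = 1" "l - k = 1"
  have e: "ev (free_x i j) = X i j" "ev (free_x k l) = X k l"
    using ijkl by (auto intro: ev_free_x)
  have "ev r = X i j * X i j * X i j * X k l
      - q_number 3 q \<cdot>\<^sub>m (X i j * X i j * X k l * X i j)
      + q_number 3 q \<cdot>\<^sub>m (X i j * X k l * X i j * X i j)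
      - X k l * X i j * X i j * X i j"
    unfolding r power3_eq_cube power2_eq_square ev_simps e
    using X_carrier by (simp add: smult_one_mult mult_smult_assoc_mat[of _ n n _ n] assoc_mult_mat[of _ n n _ n _ n]
        mult_carrier_mat[of _ n n _ n] left_mult_one_mat[of _ n n])
  then show ?thesis unfolding X_serre[OF ijkl] .
qed

lemma tet_ideal: "ideal (tet_ideal q) class_ring"
  unfolding tet_ideal_def by (rule ring.genideal_ideal[OF class_ring.ring_axioms]) simp

text \<open>The kernel of a ring homomorphism is a two-sided ideal, so it contains the ideal that the
  relators generate.\<close>

lemma ev_ideal: "p \<in> tet_ideal q \<Longrightarrow> ev p = 0\<^sub>m n n"
proof -
  note ker = ring_hom_ring.kernel_is_ideal[OF eval_mat_ring_hom[OF gen_carrier]]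
  have "tet_relators q \<subseteq> a_kernel class_ring (ring_mat TYPE('f) n ()) ev"
    by (auto simp: a_kernel_def' ring_mat_simps ev_relator)
  then have "tet_ideal q \<subseteq> a_kernel class_ring (ring_mat TYPE('f) n ()) ev"
    unfolding tet_ideal_def by (rule ring.genideal_minimal[OF class_ring.ring_axioms ker])
  then show "p \<in> tet_ideal q \<Longrightarrow> ev p = 0\<^sub>m n n" by (auto simp: a_kernel_def' ring_mat_simps)
qed

text \<open>An element of \<open>\<boxtimes>\<^sub>q\<close> is a coset; it acts through any of its representatives, and by
  \<open>act_coset\<close> the choice does not matter.\<close>

definition act :: "('f, 'f vec) tet_action" where
  "act C v = ev (SOME p. p \<in> C) *\<^sub>v v"

lemma act_coset: "act (tet_ideal q +>\<^bsub>class_ring\<^esub> p) v = ev p *\<^sub>v v"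
proof -
  have "ev p' = ev p" if "p' \<in> tet_ideal q +>\<^bsub>class_ring\<^esub> p" for p'
  proof -
    from that obtain h where "h \<in> tet_ideal q" "p' = h + p" by (auto simp: a_r_coset_def')
    then show ?thesis by (simp add: eval_mat_add ev_ideal)
  qed
  moreover have "p \<in> tet_ideal q +>\<^bsub>class_ring\<^esub> p"
  proof -
    have "0 \<in> tet_ideal q"
      using additive_subgroup.zero_closed[OF ideal.axioms(1)[OF tet_ideal]] by simp
    then show ?thesis unfolding a_r_coset_def' by force
  qed
  ultimately have "ev (SOME p'. p' \<in> tet_ideal q +>\<^bsub>class_ring\<^esub> p) = ev p" by (metis someI)
  then show ?thesis by (simp add: act_def)
qed

lemma act_tet_x: "j - i = 1 \<or> j - i = 2 \<Longrightarrow> act (tet_x q i j) v = X i j *\<^sub>v v"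
  by (simp add: tet_x_def act_coset ev_free_x)

lemma tet_algebra_carrier:
  assumes "C \<in> carrier (tet_algebra q)"
  obtains p where "C = tet_ideal q +>\<^bsub>class_ring\<^esub> p"
  using assms by (auto simp: tet_algebra_def FactRing_def A_RCOSETS_def')

lemma tet_x_carrier: "tet_x q i j \<in> carrier (tet_algebra q)"
  by (auto simp: tet_x_def tet_algebra_def FactRing_def A_RCOSETS_def')

lemma algebra_module_act: "algebra_module (tet_algebra q) (tet_scalar q) (module_vec TYPE('f) n) act"
proof (rule algebra_module.intro)
  let ?\<pi> = "\<lambda>p. tet_ideal q +>\<^bsub>class_ring\<^esub> p"
  note hom = ideal.rcos_ring_hom[OF tet_ideal, folded tet_algebra_def]
  show "vectorspace class_ring (module_vec TYPE('f) n)" by (rule vec_vs)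
  show "linear_map class_ring (module_vec TYPE('f) n) (module_vec TYPE('f) n) (act C)"
    if carr: "C \<in> carrier (tet_algebra q)" for C
  proof -
    obtain p where C: "C = ?\<pi> p" by (rule tet_algebra_carrier[OF carr])
    show ?thesis
      by (intro linear_map.intro mod_hom.intro mod_hom_axioms.intro vec_vs vec_module)
        (auto simp: LinearCombinations.module_hom_def C act_coset module_vec_simps
          mult_add_distrib_mat_vec[OF eval_mat_carrier] mult_mat_vec[OF eval_mat_carrier]
          mult_mat_vec_carrier[OF eval_mat_carrier])
  qed
  fix v assume "v \<in> carrier (module_vec TYPE('f) n)"
  then have v: "v \<in> carrier_vec n" by (simp add: module_vec_simps)
  show "act \<one>\<^bsub>tet_algebra q\<^esub> v = v"
    using v ring_hom_one[OF hom] by (simp flip: ring_hom_one[OF hom] add: act_coset eval_mat_one[OF gen_carrier])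
  show "act (tet_scalar q c) v = c \<odot>\<^bsub>module_vec TYPE('f) n\<^esub> v" for c
    using v by (simp add: tet_scalar_def act_coset eval_mat_scalar[OF gen_carrier] module_vec_simps smult_one_mult_vec)
  fix C D assume "C \<in> carrier (tet_algebra q)" "D \<in> carrier (tet_algebra q)"
  then obtain p r where CD: "C = ?\<pi> p" "D = ?\<pi> r" using tet_algebra_carrier by metis
  have "C \<oplus>\<^bsub>tet_algebra q\<^esub> D = ?\<pi> (p + r)" "C \<otimes>\<^bsub>tet_algebra q\<^esub> D = ?\<pi> (p * r)"
    using ring_hom_add[OF hom, of p r] ring_hom_mult[OF hom, of p r] by (simp_all add: CD)
  then show "act (C \<oplus>\<^bsub>tet_algebra q\<^esub> D) v = act C v \<oplus>\<^bsub>module_vec TYPE('f) n\<^esub> act D v"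
    and "act (C \<otimes>\<^bsub>tet_algebra q\<^esub> D) v = act C (act D v)"
    using v by (simp_all add: CD act_coset eval_mat_add eval_mat_mult[OF gen_carrier] module_vec_simps
      add_mult_distrib_mat_vec[OF eval_mat_carrier eval_mat_carrier]
      assoc_mult_mat_vec[OF eval_mat_carrier eval_mat_carrier])
qed

end

section \<open>Relations that imply the inverse and the cubic relations\<close>

text \<open>Multiplication by \<open>G = F\<inverse>\<close> from both sides turns \<open>F B\<close>, \<open>B F\<close>, \<open>F F\<close> into \<open>B G\<close>, \<open>G B\<close>, \<open>1\<close>. It
  reverses the order of the factors and thus replaces a relation for \<open>F\<inverse>\<close> by one in which the
  inverse does not occur.\<close>

lemma qcomm_inverse:
  assumes F: "F \<in> carrier_mat n n" and G: "G \<in> carrier_mat n n" and B: "B \<in> carrier_mat n n"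
    and FG: "F * G = 1\<^sub>m n" "G * F = 1\<^sub>m n"
  shows "qcomm q F B = k \<cdot>\<^sub>m (F * F) \<Longrightarrow> qcomm q B G = k \<cdot>\<^sub>m 1\<^sub>m n"
    and "qcomm q B F = k \<cdot>\<^sub>m (F * F) \<Longrightarrow> qcomm q G B = k \<cdot>\<^sub>m 1\<^sub>m n"
proof -
  note c = F G B mult_carrier_mat[of _ n n _ n]
  have FB: "F * B \<in> carrier_mat n n" and BF: "B * F \<in> carrier_mat n n" and FF: "F * F \<in> carrier_mat n n"
    and GB: "G * B \<in> carrier_mat n n" and BG: "B * G \<in> carrier_mat n n"
    using F B G by (auto intro: mult_carrier_mat)
  have 1: "G * (F * B) * G = B * G"
    using c FG by (simp add: assoc_mult_mat[OF G F B, symmetric])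
  have 2: "G * (B * F) * G = G * B"
    using c FG by (simp add: assoc_mult_mat[OF G BF G] assoc_mult_mat[OF B F G])
  have 3: "G * (F * F) * G = 1\<^sub>m n"
    using c FG by (simp add: assoc_mult_mat[OF G F F, symmetric])
  have conj: "G * (x \<cdot>\<^sub>m M - y \<cdot>\<^sub>m N) * G = x \<cdot>\<^sub>m (G * M * G) - y \<cdot>\<^sub>m (G * N * G)"
    if M: "M \<in> carrier_mat n n" and N: "N \<in> carrier_mat n n" for M N x y
  proof -
    have GM: "G * M \<in> carrier_mat n n" and GN: "G * N \<in> carrier_mat n n" using G M N by auto
    have "G * (x \<cdot>\<^sub>m M - y \<cdot>\<^sub>m N) = x \<cdot>\<^sub>m (G * M) - y \<cdot>\<^sub>m (G * N)"
      using mult_minus_distrib_mat[OF G smult_carrier_mat[OF M] smult_carrier_mat[OF N]]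
        mult_smult_distrib[OF G M] mult_smult_distrib[OF G N] by simp
    then show ?thesis
      using minus_mult_distrib_mat[OF smult_carrier_mat[OF GM] smult_carrier_mat[OF GN] G]
        mult_smult_assoc_mat[OF GM G] mult_smult_assoc_mat[OF GN G] by simp
  qed
  have scal: "G * (k \<cdot>\<^sub>m (F * F)) * G = k \<cdot>\<^sub>m 1\<^sub>m n"
    using mult_smult_distrib[OF G FF] mult_smult_assoc_mat[OF mult_carrier_mat[OF G FF] G] 3 by simp
  show "qcomm q F B = k \<cdot>\<^sub>m (F * F) \<Longrightarrow> qcomm q B G = k \<cdot>\<^sub>m 1\<^sub>m n"
    using conj[OF FB BF, of q "inverse q"] scal by (simp add: qcomm_def 1 2)
  show "qcomm q B F = k \<cdot>\<^sub>m (F * F) \<Longrightarrow> qcomm q G B = k \<cdot>\<^sub>m 1\<^sub>m n"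
    using conj[OF BF FB, of q "inverse q"] scal by (simp add: qcomm_def 1 2)
qed

lemma commutator_swap:
  fixes M N R :: "'a::field mat"
  assumes M: "M \<in> carrier_mat n n" and N: "N \<in> carrier_mat n n"
    and comm: "M * N - N * M = s \<cdot>\<^sub>m R"
  shows "N * M - M * N = (- s) \<cdot>\<^sub>m R"
proof -
  have "N * M - M * N = (- 1) \<cdot>\<^sub>m (M * N - N * M)"
    using M N by (intro eq_matI) (simp_all del: index_mult_mat(1))
  also have "\<dots> = (- s) \<cdot>\<^sub>m R" unfolding comm smult_smult by simp
  finally show ?thesis .
qed

text \<open>If \<open>L\<close>, \<open>R\<close> denote left and right multiplication by \<open>A\<close>, then the left-hand side is
  \<open>(L - q\<^sup>2 R) (L - q\<^sup>-\<^sup>2 R) D\<close>. The hypothesis says that one of the factors sends \<open>D\<close> to a scalar matrix,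
  and the other one sends the scalar matrix to a multiple of \<open>A\<close>. The expression does not change
  when \<open>q\<close> is replaced by \<open>q\<inverse>\<close>, so the lemma also applies to q-commutators in the opposite order.\<close>

lemma q_serre_factor:
  fixes A D :: "'a::field mat"
  assumes A: "A \<in> carrier_mat n n" and D: "D \<in> carrier_mat n n" and q: "q \<noteq> 0"
    and rel: "q \<cdot>\<^sub>m (D * A) - inverse q \<cdot>\<^sub>m (A * D) = k \<cdot>\<^sub>m 1\<^sub>m n"
  shows "A * (A * D) - (q\<^sup>2 + inverse q ^ 2) \<cdot>\<^sub>m (A * (D * A)) + D * (A * A) = (- k * (q - inverse q)) \<cdot>\<^sub>m A"
proof -
  note c = A D mult_carrier_mat[of _ n n _ n]
  have e: "(D * A) $$ (i, j) = inverse q * (inverse q * (A * D) $$ (i, j) + k * (1\<^sub>m n) $$ (i, j))"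
    if "i < n" "j < n" for i j
    using arg_cong[OF rel, of "\<lambda>M. M $$ (i, j)"] that A D q by (simp add: field_simps del: index_mult_mat(1))
  have DA: "D * A = inverse q ^ 2 \<cdot>\<^sub>m (A * D) + (inverse q * k) \<cdot>\<^sub>m 1\<^sub>m n"
    using A D e by (intro eq_matI) (simp_all add: algebra_simps power2_eq_square del: index_mult_mat(1))
  have ADA: "A * (D * A) = inverse q ^ 2 \<cdot>\<^sub>m (A * (A * D)) + (inverse q * k) \<cdot>\<^sub>m A"
    unfolding DA using c by (simp add: mult_add_distrib_mat[of _ n n _ n] mult_smult_distrib[of _ n n _ n])
  have DAA: "D * (A * A) = inverse q ^ 2 \<cdot>\<^sub>m (A * (D * A)) + (inverse q * k) \<cdot>\<^sub>m A"
  proof -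
    have "D * (A * A) = (D * A) * A" using c by (simp add: assoc_mult_mat[of _ n n _ n _ n])
    also have "\<dots> = inverse q ^ 2 \<cdot>\<^sub>m (A * (D * A)) + (inverse q * k) \<cdot>\<^sub>m A"
      by (subst DA) (use c in \<open>simp add: add_mult_distrib_mat[of _ n n _ _ n] mult_smult_assoc_mat[of _ n n _ n]
        assoc_mult_mat[of _ n n _ n _ n]\<close>)
    finally show ?thesis .
  qed
  show ?thesis
    unfolding DAA ADA using A D q
    by (intro eq_matI) (simp_all add: field_simps power2_eq_square del: index_mult_mat(1))
qed

text \<open>The cubic expression is \<open>(L - q\<^sup>2 R) (L - q\<^sup>-\<^sup>2 R) (L - R) B\<close>, and \<open>(L - R) B = s (D - C)\<close>. By
  \<open>q_serre_factor\<close> the quadratic operator sends \<open>D\<close> and \<open>C\<close> to the same matrix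
  \<open>- (q - q\<inverse>)\<^sup>2 A\<close>, so it kills the difference.\<close>

lemma q_serre_of_commutator:
  fixes A B C D :: "'a::field mat"
  assumes A: "A \<in> carrier_mat n n" and B: "B \<in> carrier_mat n n"
    and C: "C \<in> carrier_mat n n" and D: "D \<in> carrier_mat n n"
    and q: "q \<noteq> 0" "q - inverse q \<noteq> 0"
    and comm: "A * B - B * A = s \<cdot>\<^sub>m (D - C)"
    and AC: "q \<cdot>\<^sub>m (A * C) - inverse q \<cdot>\<^sub>m (C * A) = (q - inverse q) \<cdot>\<^sub>m 1\<^sub>m n"
    and DA: "q \<cdot>\<^sub>m (D * A) - inverse q \<cdot>\<^sub>m (A * D) = (q - inverse q) \<cdot>\<^sub>m 1\<^sub>m n"
  shows "A * A * A * B - q_number 3 q \<cdot>\<^sub>m (A * A * B * A) + q_number 3 q \<cdot>\<^sub>m (A * B * A * A)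
    - B * A * A * A = 0\<^sub>m n n"
proof -
  note c = A B C D mult_carrier_mat[of _ n n _ n]
  define E where "E = A * B - B * A"
  define p where "p = q\<^sup>2 + inverse q ^ 2"
  have E: "E \<in> carrier_mat n n" unfolding E_def by (intro minus_carrier_mat mult_carrier_mat[OF B A])
  have three: "q_number 3 q = p + 1"
    using q by (simp add: q_number_def p_def field_simps power2_eq_square power3_eq_cube)
  have lin: "M * (N - P) = M * N - M * P" "(N - P) * M = N * M - P * M"
    if "M \<in> carrier_mat n n" "N \<in> carrier_mat n n" "P \<in> carrier_mat n n" for M N P :: "'a mat"
    using that by (simp_all add: mult_minus_distrib_mat[of _ n n _ n] minus_mult_distrib_mat[of _ n n _ _ n])
  have AAE: "A * (A * E) = A * (A * (A * B)) - A * (A * (B * A))"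
    and AEA: "A * (E * A) = A * (A * (B * A)) - A * (B * (A * A))"
    and EAA: "E * (A * A) = A * (B * (A * A)) - B * (A * (A * A))"
    using c by (simp_all add: E_def lin assoc_mult_mat[of _ n n _ n _ n])
  have "A * A * A * B - q_number 3 q \<cdot>\<^sub>m (A * A * B * A) + q_number 3 q \<cdot>\<^sub>m (A * B * A * A) - B * A * A * A
    = A * (A * E) - p \<cdot>\<^sub>m (A * (E * A)) + E * (A * A)"
    unfolding AAE AEA EAA three using c
    by (intro eq_matI) (simp_all add: assoc_mult_mat[of _ n n _ n _ n] algebra_simps del: index_mult_mat(1))
  also have "\<dots> = s \<cdot>\<^sub>m ((A * (A * D) - p \<cdot>\<^sub>m (A * (D * A)) + D * (A * A))
      - (A * (A * C) - p \<cdot>\<^sub>m (A * (C * A)) + C * (A * A)))"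
  proof -
    have Es: "E = s \<cdot>\<^sub>m (D - C)" using comm by (simp add: E_def)
    have scaled: "M * (s \<cdot>\<^sub>m (N - P)) = s \<cdot>\<^sub>m (M * N - M * P)" "(s \<cdot>\<^sub>m (N - P)) * M = s \<cdot>\<^sub>m (N * M - P * M)"
      if M: "M \<in> carrier_mat n n" and N: "N \<in> carrier_mat n n" and P: "P \<in> carrier_mat n n" for M N P
      using lin[OF M N P] mult_smult_distrib[OF M minus_carrier_mat[OF P]]
        mult_smult_assoc_mat[OF minus_carrier_mat[OF P] M] by simp_all
    have prods: "D * A \<in> carrier_mat n n" "C * A \<in> carrier_mat n n" "A * D \<in> carrier_mat n n"
      "A * C \<in> carrier_mat n n" "A * A \<in> carrier_mat n n"
      using A C D by (auto intro: mult_carrier_mat)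
    have "A * (A * E) = s \<cdot>\<^sub>m (A * (A * D) - A * (A * C))"
      "A * (E * A) = s \<cdot>\<^sub>m (A * (D * A) - A * (C * A))"
      "E * (A * A) = s \<cdot>\<^sub>m (D * (A * A) - C * (A * A))"
      unfolding Es using scaled[OF A D C] scaled[OF A prods(3,4)] scaled[OF A prods(1,2)]
        scaled[OF prods(5) D C] by simp_all
    then show ?thesis using c
      by (intro eq_matI) (simp_all add: algebra_simps del: index_mult_mat(1))
  qed
  also have "A * (A * D) - p \<cdot>\<^sub>m (A * (D * A)) + D * (A * A) = (- (q - inverse q) * (q - inverse q)) \<cdot>\<^sub>m A"
    unfolding p_def by (rule q_serre_factor[OF A D q(1) DA])
  also have "A * (A * C) - p \<cdot>\<^sub>m (A * (C * A)) + C * (A * A)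
    = (- (- (q - inverse q)) * (inverse q - q)) \<cdot>\<^sub>m A"
  proof -
    \<comment> \<open>the relation between \<open>A\<close> and \<open>C\<close>, read as one for the parameter \<open>q\<inverse>\<close>\<close>
    have "inverse q \<cdot>\<^sub>m (C * A) - inverse (inverse q) \<cdot>\<^sub>m (A * C) = (- (q - inverse q)) \<cdot>\<^sub>m 1\<^sub>m n"
    proof (rule eq_matI)
      fix i j assume "i < dim_row ((- (q - inverse q)) \<cdot>\<^sub>m 1\<^sub>m n)" "j < dim_col ((- (q - inverse q)) \<cdot>\<^sub>m 1\<^sub>m n)"
      then have ij: "i < n" "j < n" by simp_all
      then show "(inverse q \<cdot>\<^sub>m (C * A) - inverse (inverse q) \<cdot>\<^sub>m (A * C)) $$ (i, j)
        = ((- (q - inverse q)) \<cdot>\<^sub>m 1\<^sub>m n) $$ (i, j)"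
        using arg_cong[OF AC, of "\<lambda>M. M $$ (i, j)"] A C
        by (simp add: algebra_simps del: index_mult_mat(1))
    qed (use A C in simp_all)
    from q_serre_factor[OF A C _ this] q(1) show ?thesis
      by (simp add: p_def add.commute)
  qed
  also have "s \<cdot>\<^sub>m ((- (q - inverse q) * (q - inverse q)) \<cdot>\<^sub>m A - (- (- (q - inverse q)) * (inverse q - q)) \<cdot>\<^sub>m A) = 0\<^sub>m n n"
    using A by (intro eq_matI) (simp_all add: algebra_simps)
  finally show ?thesis .
qed

section \<open>Matrices with simple spectrum\<close>

lemma mat_diag_mult_vec_index:
  fixes \<mu> :: "nat \<Rightarrow> 'a::field"
  assumes "v \<in> carrier_vec n" "i < n"
  shows "(mat_diag n \<mu> *\<^sub>v v) $ i = \<mu> i * v $ i"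
  using assms
  by (simp add: mat_diag_def scalar_prod_def if_distrib[of "\<lambda>x. x * _"] cong: if_cong)

text \<open>Take a vector \<open>v\<close> of \<open>W\<close> and an index \<open>i\<close> in its support. Subtracting \<open>\<mu> i\<close> times \<open>v\<close> from
  its image under the diagonal matrix removes exactly \<open>i\<close> from the support, as the \<open>\<mu> j\<close> are distinct.
  Repeated, this shrinks the support until one more step would give \<open>0\<close>; then \<open>v\<close> is a multiple of
  a unit vector. The lemma serves twice: for the kernel of a matrix of eigenvectors, and for
  submodules.\<close>

lemma diag_invariant_contains_unit_vec:
  fixes \<mu> :: "nat \<Rightarrow> 'a::field"
  assumes W: "W \<subseteq> carrier_vec n"
    and minus: "\<And>x y. x \<in> W \<Longrightarrow> y \<in> W \<Longrightarrow> x - y \<in> W"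
    and smult: "\<And>c x. x \<in> W \<Longrightarrow> c \<cdot>\<^sub>v x \<in> W"
    and diag: "\<And>x. x \<in> W \<Longrightarrow> mat_diag n \<mu> *\<^sub>v x \<in> W"
    and inj: "inj_on \<mu> {..<n}"
    and v: "v \<in> W" "v \<noteq> 0\<^sub>v n"
  shows "\<exists>i<n. unit_vec n i \<in> W"
  using v
proof (induction "card {i. i < n \<and> v $ i \<noteq> 0}" arbitrary: v rule: less_induct)
  case less
  have vn: "v \<in> carrier_vec n" using less W by blast
  obtain i where i: "i < n" "v $ i \<noteq> 0"
    using less(3) vn by (metis carrier_vecD eq_vecI index_zero_vec)
  define u where "u = mat_diag n \<mu> *\<^sub>v v - \<mu> i \<cdot>\<^sub>v v"
  have uW: "u \<in> W" unfolding u_def using less(2) by (intro minus smult diag)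
  have u_index: "u $ j = (\<mu> j - \<mu> i) * v $ j" if "j < n" for j
    using that vn mat_diag_mult_vec_index[OF vn that, of \<mu>]
    by (simp add: u_def left_diff_distrib mat_diag_def)
  show ?case
  proof (cases "u = 0\<^sub>v n")
    case True
    have "v $ j = 0" if "j < n" "j \<noteq> i" for j
    proof -
      have "(\<mu> j - \<mu> i) * v $ j = 0" using True u_index[OF that(1)] that by simp
      moreover have "\<mu> j \<noteq> \<mu> i" using inj that i by (auto dest: inj_onD)
      ultimately show ?thesis by simp
    qed
    then have "inverse (v $ i) \<cdot>\<^sub>v v = unit_vec n i"
      using vn i by (intro eq_vecI) (auto simp: unit_vec_def)
    with smult[OF less(2), of "inverse (v $ i)"] have "unit_vec n i \<in> W" by (simp only:)
    with i(1) show ?thesis by blast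
  next
    case False
    have "{j. j < n \<and> u $ j \<noteq> 0} \<subset> {j. j < n \<and> v $ j \<noteq> 0}"
    proof (rule psubsetI)
      show "{j. j < n \<and> u $ j \<noteq> 0} \<subseteq> {j. j < n \<and> v $ j \<noteq> 0}" using u_index by force
      have "u $ i = 0" using u_index[OF i(1)] by simp
      then show "{j. j < n \<and> u $ j \<noteq> 0} \<noteq> {j. j < n \<and> v $ j \<noteq> 0}" using i by blast
    qed
    then have "card {j. j < n \<and> u $ j \<noteq> 0} < card {j. j < n \<and> v $ j \<noteq> 0}"
      by (intro psubset_card_mono) auto
    then show ?thesis using less(1)[OF _ uW False] by blast
  qed
qed

definition simple_spectrum :: "nat \<Rightarrow> 'a::field mat \<Rightarrow> (nat \<Rightarrow> 'a) \<Rightarrow> bool" where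
  "simple_spectrum n M \<mu> \<longleftrightarrow>
     M \<in> carrier_mat n n \<and> inj_on \<mu> {..<n} \<and> (\<forall>i<n. eigenvalue M (\<mu> i))"

lemma mult_unit_vec:
  fixes A :: "'a::field mat"
  shows "A \<in> carrier_mat m n \<Longrightarrow> i < n \<Longrightarrow> A *\<^sub>v unit_vec n i = col A i"
  by (rule eq_vecI) (auto simp: carrier_matD)

text \<open>Let the columns of \<open>P\<close> be eigenvectors. As \<open>M P = P D\<close>, the kernel of \<open>P\<close> is invariant under
  the diagonal matrix \<open>D\<close> of the eigenvalues. Were it nonzero, it would contain a unit vector, and a
  column of \<open>P\<close> would vanish.\<close>

lemma simple_spectrum_eigenbasis:
  assumes "simple_spectrum n M \<mu>"
  obtains P Q where "P \<in> carrier_mat n n" "Q \<in> carrier_mat n n" "P * Q = 1\<^sub>m n" "Q * P = 1\<^sub>m n"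
    "M * P = P * mat_diag n \<mu>" "det P \<noteq> 0"
proof -
  have M: "M \<in> carrier_mat n n" and inj: "inj_on \<mu> {..<n}" and ev: "\<forall>i<n. eigenvalue M (\<mu> i)"
    using assms by (auto simp: simple_spectrum_def)
  have "\<forall>i<n. \<exists>v. v \<in> carrier_vec n \<and> v \<noteq> 0\<^sub>v n \<and> M *\<^sub>v v = \<mu> i \<cdot>\<^sub>v v"
    using ev M by (auto simp: eigenvalue_def eigenvector_def)
  then obtain w where w: "\<And>i. i < n \<Longrightarrow> w i \<in> carrier_vec n" "\<And>i. i < n \<Longrightarrow> w i \<noteq> 0\<^sub>v n"
      "\<And>i. i < n \<Longrightarrow> M *\<^sub>v w i = \<mu> i \<cdot>\<^sub>v w i"
    by metis
  define P where "P = mat n n (\<lambda>(i, j). w j $ i)"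
  have P: "P \<in> carrier_mat n n" by (simp add: P_def)
  have colP: "col P j = w j" if "j < n" for j
    using w(1)[OF that] that by (intro eq_vecI) (auto simp: P_def)
  have MP: "M * P = P * mat_diag n \<mu>"
  proof (rule mat_col_eqI)
    fix j assume "j < dim_col (P * mat_diag n \<mu>)"
    then have j: "j < n" by (simp add: mat_diag_def)
    have "col (M * P) j = \<mu> j \<cdot>\<^sub>v w j" using col_mult2[OF M P j] colP[OF j] w(3)[OF j] by simp
    also have "\<dots> = col (P * mat_diag n \<mu>) j"
      unfolding mat_diag_mult_right[OF P] using j w(1)[OF j] P by (intro eq_vecI) (auto simp: P_def)
    finally show "col (M * P) j = col (P * mat_diag n \<mu>) j" .
  qed (use M P in \<open>simp_all add: mat_diag_def\<close>)
  have det: "det P \<noteq> 0"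
  proof
    assume "det P = 0"
    then obtain v where v: "v \<in> carrier_vec n" "v \<noteq> 0\<^sub>v n" "P *\<^sub>v v = 0\<^sub>v n"
      using det_0_iff_vec_prod_zero[OF P] by blast
    define W where "W = {x \<in> carrier_vec n. P *\<^sub>v x = 0\<^sub>v n}"
    have zero: "c \<cdot>\<^sub>v 0\<^sub>v n = (0\<^sub>v n :: 'a vec)" for c by (rule eq_vecI) simp_all
    have "\<exists>i<n. unit_vec n i \<in> W"
    proof (rule diag_invariant_contains_unit_vec[OF _ _ _ _ inj])
      fix x assume "x \<in> W"
      then have x: "x \<in> carrier_vec n" "P *\<^sub>v x = 0\<^sub>v n" by (auto simp: W_def)
      have "P *\<^sub>v (mat_diag n \<mu> *\<^sub>v x) = (M * P) *\<^sub>v x"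
        unfolding MP by (rule assoc_mult_mat_vec[symmetric, OF P _ x(1)]) simp
      also have "\<dots> = M *\<^sub>v 0\<^sub>v n" using assoc_mult_mat_vec[OF M P x(1)] x(2) by simp
      also have "\<dots> = 0\<^sub>v n" using M by auto
      finally show "mat_diag n \<mu> *\<^sub>v x \<in> W"
        using x mult_mat_vec_carrier[OF mat_diag_dim x(1)] by (simp add: W_def)
      show "c \<cdot>\<^sub>v x \<in> W" for c
        using x mult_mat_vec[OF P x(1), of c] zero by (simp add: W_def)
      fix y assume "y \<in> W"
      then show "x - y \<in> W" using x P by (simp add: W_def mult_minus_distrib_mat_vec)
    qed (use v in \<open>auto simp: W_def\<close>)
    then obtain i where "i < n" "P *\<^sub>v unit_vec n i = 0\<^sub>v n" by (auto simp: W_def)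
    then show False using w(2) colP mult_unit_vec[OF P] by simp
  qed
  from det_non_zero_imp_unit[OF P det, of "()"]
  obtain Q where Q: "Q \<in> carrier_mat n n" "P * Q = 1\<^sub>m n" "Q * P = 1\<^sub>m n"
    by (auto simp: Units_def ring_mat_simps)
  show ?thesis by (rule that[OF P Q MP det])
qed

lemma simple_spectrum_upper_triangular:
  assumes "M \<in> carrier_mat n n" "upper_triangular M" "inj_on (\<lambda>i. M $$ (i, i)) {..<n}"
  shows "simple_spectrum n M (\<lambda>i. M $$ (i, i))"
  using assms unfolding simple_spectrum_def eigenvalue_root_char_poly[OF assms(1)]
  by (auto simp: char_poly_upper_triangular poly_prod_list prod_list_zero_iff diag_mat_def)

lemma simple_spectrum_transpose:
  assumes "simple_spectrum n (transpose_mat M) \<mu>" "M \<in> carrier_mat n n"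
  shows "simple_spectrum n M \<mu>"
  using assms by (auto simp: simple_spectrum_def eigenvalue_root_char_poly[of _ n] char_poly_transpose_mat[of _ n])

lemma simple_spectrum_lower_triangular:
  assumes M: "M \<in> carrier_mat n n" and lt: "\<And>i j. i < j \<Longrightarrow> j < n \<Longrightarrow> M $$ (i, j) = 0"
    and inj: "inj_on (\<lambda>i. M $$ (i, i)) {..<n}"
  shows "simple_spectrum n M (\<lambda>i. M $$ (i, i))"
proof (rule simple_spectrum_transpose[OF _ M])
  have "simple_spectrum n (transpose_mat M) (\<lambda>i. transpose_mat M $$ (i, i))"
    using M lt by (intro simple_spectrum_upper_triangular inj_on_cong[THEN iffD1, OF _ inj]) auto
  then show "simple_spectrum n (transpose_mat M) (\<lambda>i. M $$ (i, i))"
    using M by (auto simp: simple_spectrum_def inj_on_def)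
qed

lemma simple_spectrum_inverse:
  assumes M: "simple_spectrum n M \<mu>" and N: "N \<in> carrier_mat n n" "N * M = 1\<^sub>m n"
    and nz: "\<And>i. i < n \<Longrightarrow> \<mu> i \<noteq> 0"
  shows "simple_spectrum n N (\<lambda>i. inverse (\<mu> i))"
  unfolding simple_spectrum_def
proof (intro conjI allI impI)
  have Mc: "M \<in> carrier_mat n n" using M by (simp add: simple_spectrum_def)
  show "N \<in> carrier_mat n n" by fact
  show "inj_on (\<lambda>i. inverse (\<mu> i)) {..<n}" using M by (auto simp: simple_spectrum_def inj_on_def)
  fix i assume i: "i < n"
  obtain v where v: "v \<in> carrier_vec n" "v \<noteq> 0\<^sub>v n" "M *\<^sub>v v = \<mu> i \<cdot>\<^sub>v v"
    using M i by (auto simp: simple_spectrum_def eigenvalue_def eigenvector_def)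
  have "v = (N * M) *\<^sub>v v" using N v by simp
  also have "\<dots> = \<mu> i \<cdot>\<^sub>v (N *\<^sub>v v)"
    using N(1) v Mc by (simp add: assoc_mult_mat_vec[OF N(1) Mc v(1)] mult_mat_vec)
  finally have "inverse (\<mu> i) \<cdot>\<^sub>v v = N *\<^sub>v v" using nz[OF i] N v
    by (metis (no_types, lifting) left_inverse one_smult_vec smult_smult_assoc)
  then show "eigenvalue N (inverse (\<mu> i))" using v N by (auto simp: eigenvalue_def eigenvector_def)
qed

text \<open>Let \<open>T\<close> be the matrix of \<open>Y\<close> in an eigenbasis of \<open>X\<close>. The relation becomes
  \<open>(q \<mu> i - q\<inverse> \<mu> j) T\<^sub>i\<^sub>j = (q - q\<inverse>) \<delta>\<^sub>i\<^sub>j\<close>. So \<open>T\<^sub>i\<^sub>i = (\<mu> i)\<inverse>\<close>, and \<open>T\<^sub>i\<^sub>j\<close> with \<open>i \<noteq> j\<close> vanishes unless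
  \<open>\<mu> j = q\<^sup>2 \<mu> i\<close>, which \<open>step\<close> excludes below the diagonal. Hence \<open>T\<close> is triangular with distinct
  diagonal entries.\<close>

lemma simple_spectrum_raising:
  assumes X: "simple_spectrum n X \<mu>" and Y: "Y \<in> carrier_mat n n"
    and q: "q \<noteq> 0" "q - inverse q \<noteq> 0"
    and nz: "\<And>i. i < n \<Longrightarrow> \<mu> i \<noteq> 0"
    and step: "\<And>i j. j < i \<Longrightarrow> i < n \<Longrightarrow> \<mu> j \<noteq> q\<^sup>2 * \<mu> i"
    and rel: "q \<cdot>\<^sub>m (X * Y) - inverse q \<cdot>\<^sub>m (Y * X) = (q - inverse q) \<cdot>\<^sub>m 1\<^sub>m n"
  shows "simple_spectrum n Y (\<lambda>i. inverse (\<mu> i))"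
proof -
  obtain P Q where P: "P \<in> carrier_mat n n" and Q: "Q \<in> carrier_mat n n"
    and PQ: "P * Q = 1\<^sub>m n" and QP: "Q * P = 1\<^sub>m n" and XP: "X * P = P * mat_diag n \<mu>"
    by (rule simple_spectrum_eigenbasis[OF X])
  have Xc: "X \<in> carrier_mat n n" using X by (simp add: simple_spectrum_def)
  note c = P Q Xc Y mat_diag_dim[of n \<mu>]
  define T where "T = Q * (Y * P)"
  have T: "T \<in> carrier_mat n n" using c by (simp add: T_def)
  have QX: "Q * X = mat_diag n \<mu> * Q"
  proof -
    have "Q * X = Q * (X * (P * Q))" using c PQ by simp
    also have "\<dots> = Q * ((X * P) * Q)" using c by (simp add: assoc_mult_mat[of _ n n _ n _ n])
    also have "\<dots> = (Q * P) * mat_diag n \<mu> * Q" unfolding XP using c by (simp add: assoc_mult_mat[of _ n n _ n _ n])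
    finally show ?thesis using c QP by simp
  qed
  have DT: "mat_diag n \<mu> * T = Q * ((X * Y) * P)"
  proof -
    have "mat_diag n \<mu> * T = (mat_diag n \<mu> * Q) * (Y * P)"
      using c by (simp add: T_def assoc_mult_mat[of _ n n _ n _ n])
    also have "\<dots> = Q * ((X * Y) * P)" unfolding QX[symmetric] using c by (simp add: assoc_mult_mat[of _ n n _ n _ n])
    finally show ?thesis .
  qed
  have TD: "T * mat_diag n \<mu> = Q * ((Y * X) * P)"
  proof -
    have "T * mat_diag n \<mu> = Q * (Y * (P * mat_diag n \<mu>))"
      using c by (simp add: T_def assoc_mult_mat[of _ n n _ n _ n])
    also have "\<dots> = Q * ((Y * X) * P)" unfolding XP[symmetric] using c by (simp add: assoc_mult_mat[of _ n n _ n _ n])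
    finally show ?thesis .
  qed
  have XYP: "X * Y \<in> carrier_mat n n" "Y * X \<in> carrier_mat n n"
      "X * (Y * P) \<in> carrier_mat n n" "Y * (X * P) \<in> carrier_mat n n"
    using c by auto
  have "q \<cdot>\<^sub>m (mat_diag n \<mu> * T) - inverse q \<cdot>\<^sub>m (T * mat_diag n \<mu>)
    = Q * ((q \<cdot>\<^sub>m (X * Y) - inverse q \<cdot>\<^sub>m (Y * X)) * P)"
    unfolding DT TD using c XYP
    by (simp add: minus_mult_distrib_mat[of _ n n _ _ n] mult_minus_distrib_mat[of _ n n _ n]
      mult_smult_distrib[of _ n n _ n] mult_smult_assoc_mat[of _ n n _ n])
  also have "\<dots> = (q - inverse q) \<cdot>\<^sub>m 1\<^sub>m n"
    unfolding rel using c QP by (simp add: mult_smult_distrib[of _ n n] mult_smult_assoc_mat[of _ n n])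
  finally have rel_T: "q \<cdot>\<^sub>m (mat_diag n \<mu> * T) - inverse q \<cdot>\<^sub>m (T * mat_diag n \<mu>) = (q - inverse q) \<cdot>\<^sub>m 1\<^sub>m n" .
  have entry: "(q * \<mu> i - inverse q * \<mu> j) * T $$ (i, j) = (if i = j then q - inverse q else 0)"
    if "i < n" "j < n" for i j
    using arg_cong[OF rel_T, of "\<lambda>A. A $$ (i, j)"] that T
    by (cases "i = j") (simp_all add: mat_diag_mult_left[OF T] mat_diag_mult_right[OF T] algebra_simps)
  have ut: "upper_triangular T"
  proof (rule upper_triangularI)
    fix i j assume "j < i" "i < dim_row T"
    then have ij: "j < i" "i < n" using T by auto
    have "q * \<mu> i - inverse q * \<mu> j \<noteq> 0"
      using step[OF ij] q(1) by (simp add: field_simps power2_eq_square)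
    then show "T $$ (i, j) = 0" using entry[of i j] ij by simp
  qed
  have \<theta>: "T $$ (i, i) = inverse (\<mu> i)" if "i < n" for i
  proof -
    have "(q - inverse q) * (\<mu> i * T $$ (i, i)) = (q - inverse q) * 1"
      using entry[OF that that] by (simp add: algebra_simps)
    then have "\<mu> i * T $$ (i, i) = 1" using q(2) mult_left_cancel by blast
    then show ?thesis by (simp add: inverse_unique)
  qed
  have inj: "inj_on \<mu> {..<n}" using X by (simp add: simple_spectrum_def)
  have sT: "simple_spectrum n T (\<lambda>i. T $$ (i, i))"
    using inj \<theta> by (intro simple_spectrum_upper_triangular T ut) (auto simp: inj_on_def)
  have "similar_mat T Y"
    unfolding similar_mat_def similar_mat_wit_def Let_def
    using c QP PQ T by (intro exI[of _ Q] exI[of _ P]) (auto simp: T_def assoc_mult_mat[of _ n n _ n _ n])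
  then have "char_poly T = char_poly Y" by (rule char_poly_similar)
  then show ?thesis using sT \<theta> inj Y
    by (auto simp: simple_spectrum_def eigenvalue_root_char_poly[of _ n] inj_on_def)
qed

text \<open>In coordinates with respect to an eigenbasis the eigenvector equation reads
  \<open>\<mu> j c\<^sub>j = \<nu> c\<^sub>j\<close>, so only one coordinate can be nonzero.\<close>

lemma simple_spectrum_eigenspace:
  assumes "simple_spectrum n M \<mu>"
  shows "\<exists>w. (\<forall>i<n. w i \<in> carrier_vec n \<and> w i \<noteq> 0\<^sub>v n \<and> M *\<^sub>v w i = \<mu> i \<cdot>\<^sub>v w i) \<and>
    (\<forall>v \<nu>. v \<in> carrier_vec n \<longrightarrow> v \<noteq> 0\<^sub>v n \<longrightarrow> M *\<^sub>v v = \<nu> \<cdot>\<^sub>v v \<longrightarrow>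
      (\<exists>i<n. \<nu> = \<mu> i \<and> (\<exists>c. v = c \<cdot>\<^sub>v w i)))"
proof -
  obtain P Q where P: "P \<in> carrier_mat n n" and Q: "Q \<in> carrier_mat n n"
    and PQ: "P * Q = 1\<^sub>m n" and QP: "Q * P = 1\<^sub>m n" and MP: "M * P = P * mat_diag n \<mu>"
    by (rule simple_spectrum_eigenbasis[OF assms])
  have M: "M \<in> carrier_mat n n" and inj: "inj_on \<mu> {..<n}" using assms by (auto simp: simple_spectrum_def)
  have colP: "col P i \<in> carrier_vec n" if "i < n" for i using that P by (auto simp: carrier_vecI)
  have "M *\<^sub>v col P i = \<mu> i \<cdot>\<^sub>v col P i" if "i < n" for i
  proof -
    have "M *\<^sub>v col P i = col (P * mat_diag n \<mu>) i" using col_mult2[OF M P that] MP by simp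
    also have "\<dots> = \<mu> i \<cdot>\<^sub>v col P i"
      unfolding mat_diag_mult_right[OF P] using that P by (intro eq_vecI) auto
    finally show ?thesis .
  qed
  moreover have "col P i \<noteq> 0\<^sub>v n" if "i < n" for i
  proof
    assume "col P i = 0\<^sub>v n"
    then have "Q *\<^sub>v (P *\<^sub>v unit_vec n i) = 0\<^sub>v n" using mult_unit_vec[OF P that] Q by auto
    then have "unit_vec n i = (0\<^sub>v n :: 'a vec)" using assoc_mult_mat_vec[OF Q P, of "unit_vec n i"] QP by simp
    then show False using that by (metis index_unit_vec(1) index_zero_vec(1) one_neq_zero)
  qed
  moreover have "\<exists>i<n. \<nu> = \<mu> i \<and> (\<exists>c. v = c \<cdot>\<^sub>v col P i)"
    if v: "v \<in> carrier_vec n" "v \<noteq> 0\<^sub>v n" "M *\<^sub>v v = \<nu> \<cdot>\<^sub>v v" for v \<nu>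
  proof -
    define c where "c = Q *\<^sub>v v"
    have c: "c \<in> carrier_vec n" using Q v by (simp add: c_def)
    have Pc: "P *\<^sub>v c = v" using assoc_mult_mat_vec[OF P Q v(1)] PQ v by (simp add: c_def)
    have Dc: "mat_diag n \<mu> *\<^sub>v c = \<nu> \<cdot>\<^sub>v c"
    proof -
      have dc: "mat_diag n \<mu> *\<^sub>v c \<in> carrier_vec n" using mult_mat_vec_carrier[OF mat_diag_dim c] .
      have "mat_diag n \<mu> *\<^sub>v c = Q *\<^sub>v (P *\<^sub>v (mat_diag n \<mu> *\<^sub>v c))"
        using assoc_mult_mat_vec[OF Q P dc] QP dc by simp
      also have "P *\<^sub>v (mat_diag n \<mu> *\<^sub>v c) = (M * P) *\<^sub>v c"
        unfolding MP using assoc_mult_mat_vec[OF P mat_diag_dim c] by simp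
      also have "\<dots> = \<nu> \<cdot>\<^sub>v v" using assoc_mult_mat_vec[OF M P c] Pc v by simp
      also have "Q *\<^sub>v (\<nu> \<cdot>\<^sub>v v) = \<nu> \<cdot>\<^sub>v c" using mult_mat_vec[OF Q v(1)] by (simp add: c_def)
      finally show ?thesis .
    qed
    have entry: "\<mu> j * c $ j = \<nu> * c $ j" if "j < n" for j
      using arg_cong[OF Dc, of "\<lambda>x. x $ j"] mat_diag_mult_vec_index[OF c that, of \<mu>] c that by simp
    have "c \<noteq> 0\<^sub>v n" using Pc P v by auto
    then obtain i where i: "i < n" "c $ i \<noteq> 0"
      using c by (metis carrier_vecD eq_vecI index_zero_vec)
    then have l: "\<nu> = \<mu> i" using entry[of i] by simp
    have "c $ j = 0" if "j < n" "j \<noteq> i" for j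
      using entry[OF that(1)] inj that i l by (auto dest: inj_onD)
    then have "c = c $ i \<cdot>\<^sub>v unit_vec n i" using c i by (intro eq_vecI) (auto simp: unit_vec_def)
    then have "v = c $ i \<cdot>\<^sub>v col P i"
      using Pc mult_mat_vec[OF P, of "unit_vec n i" "c $ i"] mult_unit_vec[OF P i(1)] by simp
    then show ?thesis using i(1) l by blast
  qed
  ultimately show ?thesis using colP by (intro exI[of _ "col P"]) blast
qed

lemma simple_spectrum_cong:
  "(\<And>i. i < n \<Longrightarrow> \<mu> i = \<nu> i) \<Longrightarrow> simple_spectrum n M \<mu> \<longleftrightarrow> simple_spectrum n M \<nu>"
  by (auto simp: simple_spectrum_def inj_on_def)

lemma simple_spectrum_invertible:
  assumes M: "simple_spectrum n M \<mu>" and nz: "\<And>i. i < n \<Longrightarrow> \<mu> i \<noteq> 0"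
  shows "M \<in> Units (ring_mat TYPE('a::field) n ())"
proof -
  have Mc: "M \<in> carrier_mat n n" using M by (simp add: simple_spectrum_def)
  have "det M \<noteq> 0"
  proof
    assume "det M = 0"
    then obtain v where v: "v \<in> carrier_vec n" "v \<noteq> 0\<^sub>v n" "M *\<^sub>v v = 0\<^sub>v n"
      using det_0_iff_vec_prod_zero[OF Mc] by blast
    have "M *\<^sub>v v = 0 \<cdot>\<^sub>v v" unfolding v(3) using v(1) by (intro eq_vecI) auto
    with simple_spectrum_eigenspace[OF M] v(1,2) obtain i where "i < n" "0 = \<mu> i" by blast
    then show False using nz by simp
  qed
  then show ?thesis by (rule det_non_zero_imp_unit[OF Mc])
qed

context
  fixes n M \<mu> and T :: "'a::field vec \<Rightarrow> 'a vec"
  assumes spec: "simple_spectrum n M \<mu>"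
    and T: "\<And>v. v \<in> carrier_vec n \<Longrightarrow> T v = M *\<^sub>v v"
begin

interpretation vec_space "TYPE('a)" n .

lemma simple_spectrum_diagonalizable: "lin_diagonalizable V T"
proof -
  obtain P Q where P: "P \<in> carrier_mat n n" "M * P = P * mat_diag n \<mu>" "det P \<noteq> 0"
    using simple_spectrum_eigenbasis[OF spec] by metis
  have Mc: "M \<in> carrier_mat n n" using spec by (simp add: simple_spectrum_def)
  have sub: "set (cols P) \<subseteq> carrier_vec n" using P(1) cols_dim by blast
  have "distinct (cols P)"
    using det_identical_columns[OF P(1)] P(1,3) by (auto simp: distinct_conv_nth)
  then have "card (set (cols P)) = n" using P(1) by (simp add: distinct_card)
  then have "basis (set (cols P))"
    using lin_dep_cols_imp_det_0[OF P(1)] P(3) sub dim_is_n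
    by (intro dim_li_is_basis) auto
  moreover have "\<exists>\<nu>. v \<in> lin_eigenspace V T \<nu>" if "v \<in> set (cols P)" for v
  proof -
    have "\<exists>j<n. v = col P j" using that P(1) by (auto simp: cols_def)
    then obtain j where j: "j < n" "v = col P j" by blast
    have cp: "col P j \<in> carrier_vec n" using P(1) j(1) by (metis carrier_matD(1) col_dim)
    have "T v = col (M * P) j" using T[OF cp] j(2) col_mult2[OF Mc P(1) j(1)] by simp
    also have "\<dots> = \<mu> j \<cdot>\<^sub>v v" unfolding P(2) mat_diag_mult_right[OF P(1)]
      using j P(1) by (intro eq_vecI) auto
    finally show ?thesis using j(2) cp by (auto simp: lin_eigenspace_def)
  qed
  ultimately show ?thesis unfolding lin_diagonalizable_def by blast
qed

lemma simple_spectrum_eigenvalues: "lin_eigenvalues V T = \<mu> ` {..<n}"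
proof -
  from simple_spectrum_eigenspace[OF spec] obtain w where
    w_all: "\<forall>i<n. w i \<in> carrier_vec n \<and> w i \<noteq> 0\<^sub>v n \<and> M *\<^sub>v w i = \<mu> i \<cdot>\<^sub>v w i" and
    only: "\<forall>v \<nu>. v \<in> carrier_vec n \<longrightarrow> v \<noteq> 0\<^sub>v n \<longrightarrow> M *\<^sub>v v = \<nu> \<cdot>\<^sub>v v \<longrightarrow>
      (\<exists>i<n. \<nu> = \<mu> i \<and> (\<exists>c. v = c \<cdot>\<^sub>v w i))"
    by (elim exE conjE)
  have w: "w i \<in> carrier_vec n" "w i \<noteq> 0\<^sub>v n" "M *\<^sub>v w i = \<mu> i \<cdot>\<^sub>v w i" if "i < n" for i
    using w_all that by simp_all
  show ?thesis
  proof (intro equalityI subsetI)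
    fix \<nu> assume "\<nu> \<in> lin_eigenvalues V T"
    then obtain v where "v \<in> carrier_vec n" "v \<noteq> 0\<^sub>v n" "M *\<^sub>v v = \<nu> \<cdot>\<^sub>v v"
      using T by (auto simp: lin_eigenvalues_def lin_eigenspace_def)
    then show "\<nu> \<in> \<mu> ` {..<n}" using only by blast
  next
    fix \<nu> assume "\<nu> \<in> \<mu> ` {..<n}"
    then obtain i where "i < n" "\<nu> = \<mu> i" by blast
    then show "\<nu> \<in> lin_eigenvalues V T"
      using w(1-3)[of i] T[of "w i"] by (auto simp: lin_eigenvalues_def lin_eigenspace_def)
  qed
qed

lemma simple_spectrum_dim_eigenspace:
  assumes i: "i < n"
  shows "vectorspace.dim class_ring (V\<lparr>carrier := lin_eigenspace V T (\<mu> i)\<rparr>) = 1"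
proof -
  have M: "M \<in> carrier_mat n n" and inj: "inj_on \<mu> {..<n}" using spec by (auto simp: simple_spectrum_def)
  from simple_spectrum_eigenspace[OF spec] obtain w where
    w_all: "\<forall>i<n. w i \<in> carrier_vec n \<and> w i \<noteq> 0\<^sub>v n \<and> M *\<^sub>v w i = \<mu> i \<cdot>\<^sub>v w i" and
    only: "\<forall>v \<nu>. v \<in> carrier_vec n \<longrightarrow> v \<noteq> 0\<^sub>v n \<longrightarrow> M *\<^sub>v v = \<nu> \<cdot>\<^sub>v v \<longrightarrow>
      (\<exists>i<n. \<nu> = \<mu> i \<and> (\<exists>c. v = c \<cdot>\<^sub>v w i))"
    by (elim exE conjE)
  have w: "w i \<in> carrier_vec n" "w i \<noteq> 0\<^sub>v n" "M *\<^sub>v w i = \<mu> i \<cdot>\<^sub>v w i" if "i < n" for i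
    using w_all that by simp_all
  define E where "E = lin_eigenspace V T (\<mu> i)"
  have E: "E = {v \<in> carrier_vec n. M *\<^sub>v v = \<mu> i \<cdot>\<^sub>v v}" using T by (auto simp: E_def lin_eigenspace_def)
  have wi: "w i \<in> E" using w(1,3)[OF i] by (simp add: E)
  have sub: "submodule class_ring E V"
  proof
    show "E \<subseteq> carrier V" by (auto simp: E)
    show "\<zero>\<^bsub>V\<^esub> \<in> E" using M by (auto simp: E)
    show "x \<oplus>\<^bsub>V\<^esub> y \<in> E" if "x \<in> E" "y \<in> E" for x y
      using that M by (auto simp: E mult_add_distrib_mat_vec[OF M] smult_add_distrib_vec)
    show "c \<odot>\<^bsub>V\<^esub> x \<in> E" if "c \<in> carrier class_ring" "x \<in> E" for c x
      using that M by (auto simp: E mult_mat_vec[OF M] smult_smult_assoc mult.commute)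
  qed
  have "E \<subseteq> span {w i}"
  proof
    fix v assume v: "v \<in> E"
    have wspan: "w i \<in> span {w i}" using w(1)[OF i] by (simp add: span_self)
    show "v \<in> span {w i}"
    proof (cases "v = 0\<^sub>v n")
      case True
      then show ?thesis using smult_in_span[OF _ wspan, of 0] w(1)[OF i] by simp
    next
      case False
      have "v \<in> carrier_vec n" "M *\<^sub>v v = \<mu> i \<cdot>\<^sub>v v" using v by (simp_all add: E)
      with False only obtain j c where j: "j < n" "\<mu> i = \<mu> j" "v = c \<cdot>\<^sub>v w j" by blast
      then have "j = i" using inj i by (auto dest: inj_onD)
      then show ?thesis using smult_in_span[OF _ wspan, of c] w(1)[OF i] j by simp
    qed
  qed
  moreover have "span {w i} \<subseteq> E" using wi sub by (intro span_is_subset) auto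
  ultimately have span_E: "LinearCombinations.module.span class_ring (V\<lparr>carrier := E\<rparr>) {w i} = E"
    using span_li_not_depend(1)[OF _ sub, of "{w i}"] wi by simp
  have "VectorSpace.subspace class_ring E V" using sub vec_vs by (simp add: VectorSpace.subspace_def)
  then interpret E: vectorspace class_ring "V\<lparr>carrier := E\<rparr>" by (rule subspace_is_vs)
  show ?thesis unfolding E_def[symmetric]
    using span_E w(2)[OF i] wi by (intro E.dim1I[of "w i"]) auto
qed

end

section \<open>Tridiagonal matrices\<close>

text \<open>Entries below the diagonal are indexed by their row, entries above it by their column. With
  this convention the entries that would lie outside of the matrix are \<open>l 0\<close> and \<open>u (d + 1)\<close>, and if
  both vanish, then the product formulas below need no separate treatment of the first and last row.\<close>

definition tri :: "nat \<Rightarrow> (nat \<Rightarrow> 'a) \<Rightarrow> (nat \<Rightarrow> 'a) \<Rightarrow> (nat \<Rightarrow> 'a) \<Rightarrow> 'a::field mat" where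
  "tri d l m u = mat (d + 1) (d + 1) (\<lambda>(r, c).
     if r = c then m r else if r = c + 1 then l r else if c = r + 1 then u c else 0)"

lemma tri_carrier [simp]: "tri d l m u \<in> carrier_mat (d + 1) (d + 1)"
  by (simp add: tri_def)

lemma tri_carrier_Suc [simp]: "tri d l m u \<in> carrier_mat (Suc d) (Suc d)"
  using tri_carrier by simp

lemma tri_mult_index:
  assumes N: "N \<in> carrier_mat (d + 1) (d + 1)" and l: "l 0 = 0" and u: "u (d + 1) = 0"
    and i: "i \<le> d" and j: "j \<le> d"
  shows "(tri d l m u * N) $$ (i, j)
    = l i * N $$ (i - 1, j) + m i * N $$ (i, j) + u (i + 1) * N $$ (i + 1, j)"
proof -
  have "(tri d l m u * N) $$ (i, j) = (\<Sum>k\<in>{0..<d+1}. tri d l m u $$ (i, k) * N $$ (k, j))"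
    using N i j by (simp add: tri_def scalar_prod_def)
  also have "\<dots> = (\<Sum>k\<in>{0..<d+1}. (if k = i then m i * N $$ (i, j) else 0)
      + (if k + 1 = i then l i * N $$ (i - 1, j) else 0)
      + (if k = i + 1 then u (i + 1) * N $$ (i + 1, j) else 0))"
    using i by (intro sum.cong) (auto simp: tri_def)
  also have "\<dots> = m i * N $$ (i, j) + l i * N $$ (i - 1, j) + u (i + 1) * N $$ (i + 1, j)"
  proof -
    have "(\<Sum>k\<in>{0..<d+1}. if k = i then m i * N $$ (i, j) else 0) = m i * N $$ (i, j)"
      using i by simp
    moreover have "(\<Sum>k\<in>{0..<d+1}. if k + 1 = i then l i * N $$ (i - 1, j) else 0)
      = l i * N $$ (i - 1, j)"
    proof (cases i)
      case (Suc i')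
      then show ?thesis using i by simp
    qed (simp add: l)
    moreover have "(\<Sum>k\<in>{0..<d+1}. if k = i + 1 then u (i + 1) * N $$ (i + 1, j) else 0)
      = u (i + 1) * N $$ (i + 1, j)"
      using i u by (cases "i = d") auto
    ultimately show ?thesis by (simp add: sum.distrib)
  qed
  finally show ?thesis by simp
qed

lemma tri_mult_tri:
  assumes "l 0 = 0" "u (d + 1) = 0" "i \<le> d" "j \<le> d"
  shows "(tri d l m u * tri d l' m' u') $$ (i, j) =
    (if i = j then l i * u' i + m i * m' i + u (i + 1) * l' (i + 1)
     else if j = i + 1 then m i * u' j + u j * m' j
     else if i = j + 1 then l i * m' j + m i * l' i
     else if j = i + 2 then u (i + 1) * u' j
     else if i = j + 2 then l i * l' (j + 1)
     else 0)"
  unfolding tri_mult_index[OF tri_carrier, of l u d i j m l' m' u', OF assms]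
  using assms by (cases i; cases "i = d"; auto simp: tri_def)

text \<open>The hypotheses are the identities for the five bands of the products. The right-hand side is a
  product as well, so that it can be a scalar matrix, the square of a generator, or a single
  tridiagonal matrix multiplied by the identity.\<close>

lemma tri_relationI:
  assumes bd: "l1 0 = 0" "u1 (d + 1) = 0" "l2 0 = 0" "u2 (d + 1) = 0" "l3 0 = 0" "u3 (d + 1) = 0"
    and diag: "\<And>i. i \<le> d \<Longrightarrow>
      x * (l1 i * u2 i + m1 i * m2 i + u1 (i + 1) * l2 (i + 1))
      - y * (l2 i * u1 i + m2 i * m1 i + u2 (i + 1) * l1 (i + 1))
      = z * (l3 i * u4 i + m3 i * m4 i + u3 (i + 1) * l4 (i + 1))"
    and up: "\<And>i. i < d \<Longrightarrow>
      x * (m1 i * u2 (i + 1) + u1 (i + 1) * m2 (i + 1))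
      - y * (m2 i * u1 (i + 1) + u2 (i + 1) * m1 (i + 1))
      = z * (m3 i * u4 (i + 1) + u3 (i + 1) * m4 (i + 1))"
    and lo: "\<And>i. i < d \<Longrightarrow>
      x * (l1 (i + 1) * m2 i + m1 (i + 1) * l2 (i + 1))
      - y * (l2 (i + 1) * m1 i + m2 (i + 1) * l1 (i + 1))
      = z * (l3 (i + 1) * m4 i + m3 (i + 1) * l4 (i + 1))"
    and up2: "\<And>i. i + 2 \<le> d \<Longrightarrow>
      x * (u1 (i + 1) * u2 (i + 2)) - y * (u2 (i + 1) * u1 (i + 2)) = z * (u3 (i + 1) * u4 (i + 2))"
    and lo2: "\<And>i. i + 2 \<le> d \<Longrightarrow>
      x * (l1 (i + 2) * l2 (i + 1)) - y * (l2 (i + 2) * l1 (i + 1)) = z * (l3 (i + 2) * l4 (i + 1))"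
  shows "x \<cdot>\<^sub>m (tri d l1 m1 u1 * tri d l2 m2 u2) - y \<cdot>\<^sub>m (tri d l2 m2 u2 * tri d l1 m1 u1)
    = z \<cdot>\<^sub>m (tri d l3 m3 u3 * tri d l4 m4 u4)" (is "?L = ?R")
proof (rule eq_matI)
  have dims: "dim_row (tri d l m u) = d + 1" "dim_col (tri d l m u) = d + 1"
    for l m u :: "nat \<Rightarrow> 'a" by (simp_all add: tri_def)
  show "dim_row ?L = dim_row ?R" "dim_col ?L = dim_col ?R" by (simp_all add: dims)
  fix i j assume "i < dim_row ?R" "j < dim_col ?R"
  then have ij: "i \<le> d" "j \<le> d" by (simp_all add: dims)
  have "?L $$ (i, j) = x * (tri d l1 m1 u1 * tri d l2 m2 u2) $$ (i, j)
      - y * (tri d l2 m2 u2 * tri d l1 m1 u1) $$ (i, j)"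
    using ij by (simp add: dims del: index_mult_mat(1))
  also have "\<dots> = z * (tri d l3 m3 u3 * tri d l4 m4 u4) $$ (i, j)"
    unfolding tri_mult_tri[of l1 u1, OF bd(1,2) ij] tri_mult_tri[of l2 u2, OF bd(3,4) ij]
      tri_mult_tri[of l3 u3, OF bd(5,6) ij]
    using ij diag[of i] up[of i] lo[of j] up2[of i] lo2[of j] by auto
  also have "\<dots> = ?R $$ (i, j)"
    using ij by (simp add: dims del: index_mult_mat(1))
  finally show "?L $$ (i, j) = ?R $$ (i, j)" .
qed

lemma tri_one: "tri d (\<lambda>_. 0) (\<lambda>_. 1) (\<lambda>_. 0) = 1\<^sub>m (d + 1)"
  by (rule eq_matI) (auto simp: tri_def)

lemma tri_minus:
  "tri d l m u - tri d l' m' u' = tri d (\<lambda>i. l i - l' i) (\<lambda>i. m i - m' i) (\<lambda>i. u i - u' i)"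
  by (rule eq_matI) (auto simp: tri_def)

section \<open>Coordinates and reversal of the basis\<close>

lemma represents_unit_vec:
  assumes M: "M \<in> carrier_mat (d + 1) (d + 1)"
    and T: "\<And>v. v \<in> carrier_vec (d + 1) \<Longrightarrow> T v = M *\<^sub>v (v :: 'a::field vec)"
  shows "represents d (module_vec TYPE('a) (d + 1)) (unit_vec (d + 1)) M T"
  unfolding represents_def
proof (intro conjI ballI M)
  interpret vec_space "TYPE('a)" "d + 1" .
  fix n assume "n \<in> {0..d}"
  then have n: "n < d + 1" by auto
  let ?S = "finsum_vec TYPE('a) (d + 1) (\<lambda>i. M $$ (i, n) \<cdot>\<^sub>v unit_vec (d + 1) i) {0..d}"
  have "col M n = ?S"
  proof (rule eq_vecI)
    have S: "?S \<in> carrier_vec (d + 1)" by (rule finsum_vec_closed) auto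
    then show "dim_vec (col M n) = dim_vec ?S" using M by simp
    fix i assume "i < dim_vec ?S"
    then have i: "i < d + 1" using S by simp
    have "?S $ i = (\<Sum>j\<in>{0..d}. (M $$ (j, n) \<cdot>\<^sub>v unit_vec (d + 1) j) $ i)"
      by (rule index_finsum_vec) (use i in auto)
    also have "\<dots> = (\<Sum>j\<in>{0..d}. if j = i then M $$ (i, n) else 0)"
      using i by (intro sum.cong) (auto simp: unit_vec_def)
    also have "\<dots> = M $$ (i, n)" using i by simp
    finally show "col M n $ i = ?S $ i" using M n i by simp
  qed
  then show "T (unit_vec (d + 1) n) = (\<Oplus>\<^bsub>module_vec TYPE('a) (d + 1)\<^esub>i\<in>{0..d}.
      M $$ (i, n) \<odot>\<^bsub>module_vec TYPE('a) (d + 1)\<^esub> unit_vec (d + 1) i)"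
    unfolding module_vec_simps finsum_vec[symmetric]
    using mult_unit_vec[OF M n] T[of "unit_vec (d + 1) n"] unit_vec_carrier by metis
qed

lemma indexed_basis_unit_vec:
  "indexed_basis d (module_vec TYPE('a::field) (d + 1)) (unit_vec (d + 1))"
proof -
  interpret vec_space "TYPE('a)" "d + 1" .
  have "unit_vec (d + 1) ` {0..d} = set (unit_vecs (d + 1) :: 'a vec list)"
    by (auto simp: unit_vecs_def)
  moreover have "inj_on (unit_vec (d + 1) :: nat \<Rightarrow> 'a vec) {0..d}"
  proof (rule inj_onI)
    fix i j assume ij: "i \<in> {0..d}" "j \<in> {0..d}" and "unit_vec (d + 1) i = (unit_vec (d + 1) j :: 'a vec)"
    then have "unit_vec (d + 1) i $ i = (unit_vec (d + 1) j $ i :: 'a)" by simp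
    then show "i = j" using ij by (auto split: if_splits)
  qed
  ultimately show ?thesis using unit_vecs_basis by (simp add: indexed_basis_def)
qed

lemma mult_index:
  assumes "A \<in> carrier_mat m n" "B \<in> carrier_mat n p" "i < m" "j < p"
  shows "(A * B) $$ (i, j) = (\<Sum>k\<in>{0..<n}. A $$ (i, k) * B $$ (k, j))"
  using assms by (simp add: scalar_prod_def)

text \<open>Conjugation by \<^const>\<open>Z_mat\<close> reverses the order of the basis.\<close>

lemma Z_mat_conjugate_index:
  assumes M: "M \<in> carrier_mat (d + 1) (d + 1)" and r: "r \<le> d" and c: "c \<le> d"
  shows "(Z_mat d * M * Z_mat d) $$ (r, c) = M $$ (d - r, d - c)"
proof -
  have Z: "Z_mat d \<in> carrier_mat (d + 1) (d + 1)" by (simp add: Z_mat_def)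
  have left: "(Z_mat d * M) $$ (r, j) = M $$ (d - r, j)" if "j \<le> d" for j
  proof -
    have "(if r + k = d then 1 else 0) * M $$ (k, j) = (if k = d - r then M $$ (d - r, j) else 0)" for k
      using r by auto
    then show ?thesis
      using M r that by (simp add: Z_mat_def scalar_prod_def del: sum.op_ivl_Suc)
  qed
  have "(Z_mat d * M * Z_mat d) $$ (r, c)
    = (\<Sum>k\<in>{0..<d+1}. (Z_mat d * M) $$ (r, k) * Z_mat d $$ (k, c))"
    using mult_index[OF mult_carrier_mat[OF Z M] Z] r c by simp
  also have "\<dots> = (\<Sum>k\<in>{0..<d+1}. if k = d - c then M $$ (d - r, d - c) else 0)"
    using c left by (intro sum.cong) (auto simp: Z_mat_def simp del: index_mult_mat(1))
  finally show ?thesis by simp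
qed

section \<open>The eight matrices and their relations\<close>

locale evaluation_matrices =
  fixes q t :: "'f::field" and d :: nat
  assumes q0: "q \<noteq> 0"
    and q_not_root: "\<And>n. n > 0 \<Longrightarrow> q ^ n \<noteq> 1"
    and d1: "d \<ge> 1"
    and t0: "t \<noteq> 0"
    and t_generic: "t \<notin> {q powi (int d - 2 * int n + 1) | n. n \<in> {1..d}}"
begin

text \<open>The entries of the matrices in terms of \<open>\<alpha>\<close> and \<open>\<beta>\<close>. Negative powers of \<open>q\<close> appear as quotients,
  so that all identities between entries are decided by clearing denominators; the only facts about
  powers that they use are \<open>\<beta> (i + 1) = q\<^sup>2 \<beta> i\<close> and the values \<open>\<beta> 0 = 1\<close>, \<open>\<beta> d = \<alpha>\<^sup>2\<close>, which make
  the entries outside of the matrix vanish. The eigenvalue \<open>\<theta> i\<close> is \<open>q\<^sup>2\<^sup>i\<^sup>-\<^sup>d\<close>.\<close>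

definition "\<alpha> = q ^ d"
definition "\<beta> i = q ^ (2 * i)"
definition "\<theta> i = \<beta> i / \<alpha>"
definition "lower_31 i = (1 - \<beta> i) / \<alpha>"
definition "upper_12 i = \<alpha> - \<beta> i / (q\<^sup>2 * \<alpha>)"
definition "lower_30 i = lower_31 i * (1 - t * q * \<alpha> / \<beta> i)"
definition "upper_02 i = upper_12 i / (1 - t * q * \<alpha> / \<beta> i)"
definition "lower_01 i = lower_31 i * (1 - \<beta> i / (t * q * \<alpha>))"
definition "upper_01 i = - upper_12 i * (\<beta> i / (t * q * \<alpha>))"
definition "diag_01 i = 1 / \<alpha> - (\<beta> i / \<alpha> - \<alpha>) * (q * \<beta> i / \<alpha>) / t
   - (1 - \<beta> i) / \<alpha> * (1 - \<beta> i / (t * q * \<alpha>))"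
definition "\<kappa> = q - inverse q"

lemma \<alpha>_nonzero [simp]: "\<alpha> \<noteq> 0" and \<beta>_nonzero [simp]: "\<beta> i \<noteq> 0"
  using q0 by (simp_all add: \<alpha>_def \<beta>_def)

lemma \<beta>_0: "\<beta> 0 = 1" and \<beta>_Suc: "\<beta> (Suc i) = q * q * \<beta> i" and \<beta>_d: "\<beta> d = \<alpha> * \<alpha>"
  by (simp_all add: \<alpha>_def \<beta>_def mult_2 power_add)

lemma entries_at_boundary [simp]:
  "lower_31 0 = 0" "upper_12 (d + 1) = 0" "upper_12 (Suc d) = 0" "lower_30 0 = 0"
  "upper_02 (d + 1) = 0" "upper_02 (Suc d) = 0"
  "lower_01 0 = 0" "upper_01 (d+1) = 0" "upper_01 (Suc d) = 0"
  using q0 by (simp_all add: lower_31_def upper_12_def lower_30_def upper_02_def lower_01_def upper_01_def \<beta>_0 \<beta>_Suc \<beta>_d power2_eq_square)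

definition "x12 = tri d (\<lambda>_. 0) \<theta> upper_12"
definition "x23 = tri d (\<lambda>_. 0) (\<lambda>i. 1 / \<theta> i) (\<lambda>_. 0)"
definition "x31 = tri d lower_31 \<theta> (\<lambda>_. 0)"
definition "x30 = tri d lower_30 \<theta> (\<lambda>_. 0)"
definition "x02 = tri d (\<lambda>_. 0) \<theta> upper_02"
definition "x01 = tri d lower_01 diag_01 upper_01"

abbreviation (input) "one_tri \<equiv> tri d (\<lambda>_. 0) (\<lambda>_. 1) (\<lambda>_. 0 :: 'f)"

lemma one_smult_tri: "x \<cdot>\<^sub>m 1\<^sub>m (d+1) = x \<cdot>\<^sub>m (one_tri * one_tri)"
  by (simp add: tri_one)

text \<open>This is where the excluded values of \<open>t\<close> enter: the entries of \<open>x02\<close> have these denominators.\<close>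

lemma denominator_nonzero: assumes "1 \<le> i" "i \<le> d" shows "1 - t * q * \<alpha> / \<beta> i \<noteq> 0"
proof
  assume "1 - t * q * \<alpha> / \<beta> i = 0"
  then have "t = q ^ (2*i) / (q * q ^ d)" using q0 by (simp add: field_simps \<alpha>_def \<beta>_def)
  also have "\<dots> = q powi (int (2*i) - int (1 + d))"
    using q0 by (simp add: power_int_diff del: of_nat_mult of_nat_add of_nat_Suc)
  also have "int (2*i) - int (1 + d) = int d - 2 * int (d + 1 - i) + 1" using assms by simp
  finally have "t = q powi (int d - 2 * int (d + 1 - i) + 1)" .
  moreover have "d + 1 - i \<in> {1..d}" using assms by auto
  ultimately show False using t_generic by blast
qed

lemma upper_12_eq: assumes "1 \<le> i" "i \<le> Suc d" shows "upper_12 i = upper_02 i * (1 - t * q * \<alpha> / \<beta> i)"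
  using denominator_nonzero[of i] assms by (cases "i = Suc d") (simp_all add: upper_02_def)

text \<open>The factor that distinguishes \<open>x30\<close> from \<open>x31\<close> below the diagonal is the inverse of the one that
  distinguishes \<open>x02\<close> from \<open>x12\<close> above it. For \<open>i = 0\<close> and \<open>i = d + 1\<close>, where the denominator may
  vanish, both sides are \<open>0\<close>.\<close>

lemma lower_30_upper_02: assumes "i \<le> Suc d" shows "lower_30 i * upper_02 i = lower_31 i * upper_12 i"
  using upper_12_eq[of i] assms by (cases "i = 0") (simp_all add: lower_30_def)

lemma lower_01_eq: "lower_01 i = - lower_30 i * (\<beta> i / (t * q * \<alpha>))"
  using q0 t0 by (simp add: lower_01_def lower_30_def field_simps)

lemma lower_01_upper_02: assumes "i \<le> Suc d" shows "lower_01 i * upper_02 i = lower_31 i * upper_01 i"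
  using lower_30_upper_02[OF assms] by (simp add: lower_01_eq upper_01_def)

lemmas entry_defs = lower_31_def upper_12_def \<theta>_def lower_30_def lower_01_def upper_01_def diag_01_def \<kappa>_def \<beta>_Suc \<beta>_0 \<beta>_d

lemma qcomm_12_23: "qcomm q x12 x23 = \<kappa> \<cdot>\<^sub>m 1\<^sub>m (d+1)"
  unfolding qcomm_def x12_def x23_def one_smult_tri
  by (rule tri_relationI) (use q0 t0 in \<open>simp_all add: entry_defs field_simps power2_eq_square\<close>)

lemma qcomm_23_30: "qcomm q x23 x30 = \<kappa> \<cdot>\<^sub>m 1\<^sub>m (d+1)"
  unfolding qcomm_def x23_def x30_def one_smult_tri
  by (rule tri_relationI) (use q0 t0 in \<open>simp_all add: entry_defs field_simps power2_eq_square\<close>)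

lemma qcomm_23_31: "qcomm q x23 x31 = \<kappa> \<cdot>\<^sub>m 1\<^sub>m (d+1)"
  unfolding qcomm_def x23_def x31_def one_smult_tri
  by (rule tri_relationI) (use q0 t0 in \<open>simp_all add: entry_defs field_simps power2_eq_square\<close>)

lemma qcomm_31_12: "qcomm q x31 x12 = \<kappa> \<cdot>\<^sub>m 1\<^sub>m (d+1)"
  unfolding qcomm_def x31_def x12_def one_smult_tri
  by (rule tri_relationI) (use q0 t0 in \<open>simp_all add: entry_defs field_simps power2_eq_square\<close>)

lemma qcomm_02_23: "qcomm q x02 x23 = \<kappa> \<cdot>\<^sub>m 1\<^sub>m (d+1)"
  unfolding qcomm_def x02_def x23_def one_smult_tri
  by (rule tri_relationI) (use q0 t0 in \<open>simp_all add: entry_defs field_simps power2_eq_square\<close>)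

lemma qcomm_01_12: "qcomm q x01 x12 = \<kappa> \<cdot>\<^sub>m 1\<^sub>m (d+1)"
  unfolding qcomm_def x01_def x12_def one_smult_tri
  by (rule tri_relationI) (use q0 t0 in \<open>simp_all add: entry_defs field_simps power2_eq_square\<close>)

lemma qcomm_30_01: "qcomm q x30 x01 = \<kappa> \<cdot>\<^sub>m 1\<^sub>m (d+1)"
  unfolding qcomm_def x30_def x01_def one_smult_tri
  by (rule tri_relationI) (use q0 t0 in \<open>simp_all add: entry_defs field_simps power2_eq_square\<close>)

lemma qcomm_30_31: "qcomm q x30 x31 = \<kappa> \<cdot>\<^sub>m (x31 * x31)"
  unfolding qcomm_def x30_def x31_def
  by (rule tri_relationI) (use q0 t0 in \<open>simp_all add: entry_defs field_simps power2_eq_square\<close>)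

lemma qcomm_31_01: "qcomm q x31 x01 = \<kappa> \<cdot>\<^sub>m (x31 * x31)"
  unfolding qcomm_def x31_def x01_def
  by (rule tri_relationI) (use q0 t0 in \<open>simp_all add: entry_defs field_simps power2_eq_square\<close>)

lemma tri_one_mult: "one_tri * tri d l m u = tri d l m u"
  unfolding tri_one by (rule left_mult_one_mat[OF tri_carrier])

text \<open>The cubic relations rest on this identity and the next one.\<close>

lemma commutator_30_12: "x30 * x12 - x12 * x30 = (t * \<kappa>) \<cdot>\<^sub>m (x01 - x23)"
proof -
  have "1 \<cdot>\<^sub>m (x30 * x12) - 1 \<cdot>\<^sub>m (x12 * x30) = (t * \<kappa>) \<cdot>\<^sub>m (one_tri * (x01 - x23))"
    unfolding x12_def x30_def x23_def x01_def tri_minus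
    by (rule tri_relationI) (use q0 t0 in \<open>simp_all add: entry_defs field_simps power2_eq_square\<close>)
  then show ?thesis by (simp add: smult_one x23_def x01_def tri_minus tri_one_mult)
qed

lemma commutator_01_23: "x01 * x23 - x23 * x01 = (\<kappa> / t) \<cdot>\<^sub>m (x12 - x30)"
proof -
  have "1 \<cdot>\<^sub>m (x01 * x23) - 1 \<cdot>\<^sub>m (x23 * x01) = (\<kappa> / t) \<cdot>\<^sub>m (one_tri * (x12 - x30))"
    unfolding x12_def x30_def x23_def x01_def tri_minus
    by (rule tri_relationI) (use q0 t0 in \<open>simp_all add: entry_defs field_simps power2_eq_square\<close>)
  then show ?thesis by (simp add: smult_one x12_def x30_def tri_minus tri_one_mult)
qed

text \<open>In the relations of \<open>x02\<close> its entries above the diagonal are treated as unknowns: on the diagonal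
  the products with \<open>lower_30\<close> and \<open>lower_01\<close> are free of denominators, and on the other bands
  \<open>upper_12\<close> is expressed through \<open>upper_02\<close>. The cases 7, 8 and 10 are the diagonal and the first and
  second band above it.\<close>

lemma qcomm_30_02: "qcomm q x30 x02 = \<kappa> \<cdot>\<^sub>m 1\<^sub>m (d+1)"
  unfolding qcomm_def x30_def x02_def one_smult_tri
proof (rule tri_relationI, goal_cases)
  case (7 i)
  have *: "lower_30 i * upper_02 i = lower_31 i * upper_12 i" "upper_02 (i+1) * lower_30 (i+1) = lower_31 (i+1) * upper_12 (i+1)"
    using 7 lower_30_upper_02[of i] lower_30_upper_02[of "i+1"] by (simp_all add: mult.commute)
  show ?case unfolding * using q0 t0 by (simp add: entry_defs field_simps power2_eq_square)
qed (use q0 t0 in \<open>simp_all add: entry_defs field_simps power2_eq_square\<close>)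

lemma qcomm_02_12: "qcomm q x02 x12 = \<kappa> \<cdot>\<^sub>m (x02 * x02)"
  unfolding qcomm_def x12_def x02_def
proof (rule tri_relationI, goal_cases)
  case (8 i)
  then show ?case using q0 t0 by (simp add: upper_12_eq \<theta>_def \<kappa>_def \<beta>_Suc field_simps)
next
  case (10 i)
  then show ?case using q0 t0 by (simp add: upper_12_eq \<theta>_def \<kappa>_def \<beta>_Suc field_simps)
qed (use q0 t0 in \<open>simp_all add: entry_defs field_simps power2_eq_square\<close>)

lemma qcomm_01_02: "qcomm q x01 x02 = \<kappa> \<cdot>\<^sub>m (x02 * x02)"
  unfolding qcomm_def x01_def x02_def
proof (rule tri_relationI, goal_cases)
  case (7 i)
  have *: "lower_01 i * upper_02 i = lower_31 i * upper_01 i" "upper_02 (i+1) * lower_01 (i+1) = lower_31 (i+1) * upper_01 (i+1)"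
    using 7 lower_01_upper_02[of i] lower_01_upper_02[of "i+1"] by (simp_all add: mult.commute)
  show ?case unfolding * using q0 t0 by (simp add: entry_defs field_simps power2_eq_square)
next
  case (8 i)
  then show ?case using q0 t0 by (simp add: upper_12_eq \<theta>_def diag_01_def upper_01_def \<kappa>_def \<beta>_Suc field_simps)
next
  case (10 i)
  then show ?case using q0 t0 by (simp add: upper_12_eq upper_01_def \<kappa>_def \<beta>_Suc field_simps)
qed (use q0 t0 in \<open>simp_all add: entry_defs field_simps power2_eq_square\<close>)

section \<open>Agreement with the prescribed matrices\<close>

lemma x_carrier: "x12 \<in> carrier_mat (d+1) (d+1)" "x30 \<in> carrier_mat (d+1) (d+1)" "x23 \<in> carrier_mat (d+1) (d+1)"
  "x01 \<in> carrier_mat (d+1) (d+1)" "x31 \<in> carrier_mat (d+1) (d+1)" "x02 \<in> carrier_mat (d+1) (d+1)"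
  by (simp_all only: x12_def x30_def x23_def x01_def x31_def x02_def tri_carrier)

lemma powi_\<theta>: "e = 2 * int i - int d + m \<Longrightarrow> q powi e = \<theta> i * q powi m"
  using q0 by (simp add: power_int_add power_int_diff \<theta>_def \<beta>_def \<alpha>_def power_int_mult power_mult)
lemma powi_inverse_\<theta>: "e = int d - 2 * int i + m \<Longrightarrow> q powi e = 1 / \<theta> i * q powi m"
  using q0 by (simp add: power_int_add power_int_diff \<theta>_def \<beta>_def \<alpha>_def power_int_mult power_mult)
lemma powi_d: "q powi int d = \<alpha>" "q ^ d = \<alpha>" "q powi (- int d) = 1 / \<alpha>"
  using q0 by (simp_all add: power_int_minus \<alpha>_def divide_inverse)

lemma powi_small: "q powi (- 2) = 1 / q\<^sup>2" "q powi 2 = q\<^sup>2" "q powi (- 1) = 1 / q" "q powi 1 = q"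
  using q0 by (simp_all add: power_int_minus divide_inverse)

lemma mat_Suc_eqI:
  assumes "M \<in> carrier_mat (d + 1) (d + 1)" "N \<in> carrier_mat (d + 1) (d + 1)"
    and "\<And>r c. r \<le> d \<Longrightarrow> c \<le> d \<Longrightarrow> M $$ (r, c) = N $$ (r, c)"
  shows "M = N"
  using assms by (intro eq_matI) auto

lemma E_mat_eq: "E_mat d q = x12"
proof (rule mat_Suc_eqI)
  fix r c assume rc: "r \<le> d" "c \<le> d"
  have 1: "q powi (2 * int r - int d) = \<theta> r"
    by (subst powi_\<theta>[of _ r 0]) simp_all
  have 2: "q powi (2 * int c - 2 - int d) = \<beta> c / (q\<^sup>2 * \<alpha>)"
    by (subst powi_\<theta>[of _ c "-2"]) (simp_all add: powi_small \<theta>_def)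
  show "E_mat d q $$ (r, c) = x12 $$ (r, c)"
    using rc 1 2 by (auto simp: E_mat_def x12_def tri_def upper_12_def powi_d)
qed (simp_all add: E_mat_def x12_def)

lemma K_mat_eq: "K_mat d q = x23"
proof (rule mat_Suc_eqI)
  fix r c assume rc: "r \<le> d" "c \<le> d"
  have "q powi (int d - 2 * int r) = 1 / \<theta> r"
    by (subst powi_inverse_\<theta>[of _ r 0]) simp_all
  then show "K_mat d q $$ (r, c) = x23 $$ (r, c)"
    using rc by (auto simp: K_mat_def x23_def tri_def)
qed (simp_all add: K_mat_def x23_def)

lemma L_mat_eq: "L_mat d q t = x02"
proof (rule mat_Suc_eqI)
  fix r c assume rc: "r \<le> d" "c \<le> d"
  have 1: "q powi (2 * int r - int d) = \<theta> r"
    by (subst powi_\<theta>[of _ r 0]) simp_all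
  have 2: "q powi (2 * int c - 2 - int d) = \<beta> c / (q\<^sup>2 * \<alpha>)"
    by (subst powi_\<theta>[of _ c "-2"]) (simp_all add: powi_small \<theta>_def)
  have 3: "q powi (int d - 2 * int c + 1) = q * \<alpha> / \<beta> c"
    by (subst powi_inverse_\<theta>[of _ c 1]) (simp_all add: powi_small \<theta>_def)
  show "L_mat d q t $$ (r, c) = x02 $$ (r, c)"
    using rc 1 2 3 by (auto simp: L_mat_def x02_def tri_def upper_02_def upper_12_def powi_d divide_inverse mult.assoc)
qed (simp_all add: L_mat_def x02_def)

lemma Z_conjugate_eqI:
  assumes "M \<in> carrier_mat (d + 1) (d + 1)" "N \<in> carrier_mat (d + 1) (d + 1)"
    and "\<And>r c. r \<le> d \<Longrightarrow> c \<le> d \<Longrightarrow> M $$ (d - r, d - c) = N $$ (r, c)"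
  shows "Z_mat d * M * Z_mat d = N"
proof (rule eq_matI)
  fix i j assume "i < dim_row N" "j < dim_col N"
  then show "(Z_mat d * M * Z_mat d) $$ (i, j) = N $$ (i, j)"
    using assms Z_mat_conjugate_index[OF assms(1)] by auto
qed (use assms in \<open>auto simp: Z_mat_def\<close>)

lemma inverse_powi: "inverse q powi e = q powi (- e)"
  by (simp add: power_int_minus power_int_inverse)

lemma ZEZ_eq: "Z_mat d * E_mat d (inverse q) * Z_mat d = x31"
proof (rule Z_conjugate_eqI)
  fix r c assume rc: "r \<le> d" "c \<le> d"
  have 1: "q powi (- (2 * int (d - r) - int d)) = \<theta> r" by (subst powi_\<theta>[of _ r 0]) (use rc in \<open>simp_all\<close>)
  have 2: "q powi (- (2 * int (d - c) - 2 - int d)) = \<theta> r" if "r = Suc c" by (subst powi_\<theta>[of _ r 0]) (use that rc in \<open>simp_all\<close>)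
  have 3: "q powi (- int d) = 1 / \<alpha>" by (rule powi_d(3))
  show "E_mat d (inverse q) $$ (d - r, d - c) = x31 $$ (r, c)"
    using rc 1 2 3 unfolding E_mat_def x31_def tri_def inverse_powi
    by (auto simp: lower_31_def \<theta>_def diff_divide_distrib)
qed (simp_all add: E_mat_def x31_def)

lemma ZGZ_eq: "Z_mat d * G_mat d (inverse q) t * Z_mat d = x30"
proof (rule Z_conjugate_eqI)
  fix r c assume rc: "r \<le> d" "c \<le> d"
  have 1: "q powi (- (2 * int (d - r) - int d)) = \<theta> r" by (subst powi_\<theta>[of _ r 0]) (use rc in \<open>simp_all\<close>)
  have 2: "q powi (- (2 * int (d - c) - 2 - int d)) = \<theta> r" if "r = Suc c" by (subst powi_\<theta>[of _ r 0]) (use that rc in \<open>simp_all\<close>)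
  have 3: "q powi (- int d) = 1 / \<alpha>" by (rule powi_d(3))
  have 4: "q powi (- (int d - 2 * int (d - c) + 1)) = q * \<alpha> / \<beta> r" if "r = Suc c"
    by (subst powi_inverse_\<theta>[of _ r 1]) (use that rc in \<open>simp_all add: powi_small \<theta>_def\<close>)
  show "G_mat d (inverse q) t $$ (d - r, d - c) = x30 $$ (r, c)"
    using rc 1 2 3 4 unfolding G_mat_def x30_def tri_def inverse_powi
    by (auto simp: lower_31_def lower_30_def \<theta>_def diff_divide_distrib mult.assoc)
qed (simp_all add: G_mat_def x30_def)

lemma ZSZ_eq: "Z_mat d * S_mat d (inverse q) (inverse t) * Z_mat d = x01"
proof (rule Z_conjugate_eqI)
  fix r c assume rc: "r \<le> d" "c \<le> d"
  have 1: "q powi (- (2 * int (d - r) - int d)) = \<theta> r" by (subst powi_\<theta>[of _ r 0]) (use rc in \<open>simp_all\<close>)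
  have 2: "q powi (- (2 * int (d - c) - int d - 2)) = \<theta> r" if "r = Suc c" by (subst powi_\<theta>[of _ r 0]) (use that rc in \<open>simp_all\<close>)
  have 3: "q powi (- int d) = 1 / \<alpha>" "q powi (- (- int d)) = \<alpha>" using powi_d by simp_all
  have 4: "q powi (- (2 * int (d - c) - int d - 1)) = \<theta> r * (1 / q)" if "r = Suc c"
    by (subst powi_\<theta>[of _ r "-1"]) (use that rc in \<open>simp_all add: powi_small divide_inverse\<close>)
  have 5: "q powi (- (2 * int (d - r) - int d - 1)) = \<theta> r * q"
    by (subst powi_\<theta>[of _ r 1]) (use rc in \<open>simp_all add: powi_small divide_inverse\<close>)
  have 6: "q powi (- (2 * int (d - r) - int d + 1)) = \<theta> r * (1 / q)"
    by (subst powi_\<theta>[of _ r "-1"]) (use rc in \<open>simp_all add: powi_small divide_inverse\<close>)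
  consider "r = c" | "r = Suc c" | "c = Suc r" | "r \<noteq> c" "r \<noteq> Suc c" "c \<noteq> Suc r" by blast
  then show "S_mat d (inverse q) (inverse t) $$ (d - r, d - c) = x01 $$ (r, c)"
  proof cases
    case 1
    then have "S_mat d (inverse q) (inverse t) $$ (d - r, d - c) = 1 / \<alpha> - (\<theta> r - \<alpha>) * (\<theta> r * q) * inverse t
        - (1 / \<alpha> - \<theta> r) * (1 - inverse t * (\<theta> r * (1 / q)))"
      using rc q0 t0 \<open>q powi (- (2 * int (d - r) - int d)) = \<theta> r\<close> 3 5 6
      unfolding S_mat_def inverse_powi by simp
    also have "\<dots> = diag_01 r" using q0 t0 by (simp add: diag_01_def \<theta>_def field_simps)
    finally show ?thesis using 1 rc by (simp add: x01_def tri_def)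
  next
    case 2
    then have "d - r + 1 = d - c" using rc by simp
    with 2 have "S_mat d (inverse q) (inverse t) $$ (d - r, d - c)
        = (1 / \<alpha> - \<theta> r) * (1 - inverse t * (\<theta> r * (1 / q)))"
      using rc q0 t0 \<open>r = Suc c \<Longrightarrow> q powi (- (2 * int (d - c) - int d - 2)) = \<theta> r\<close> 3 4
      unfolding S_mat_def inverse_powi by simp
    also have "\<dots> = lower_01 r" using q0 t0 by (simp add: lower_01_def lower_31_def \<theta>_def field_simps)
    finally show ?thesis using 2 rc by (simp add: x01_def tri_def)
  next
    case 3
    then have "d - r = d - c + 1" using rc by simp
    with 3 have "S_mat d (inverse q) (inverse t) $$ (d - r, d - c) = (\<theta> r - \<alpha>) * (\<theta> r * q) * inverse t"
      using rc q0 t0 \<open>q powi (- (2 * int (d - r) - int d)) = \<theta> r\<close> powi_d 5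
      unfolding S_mat_def inverse_powi by simp
    also have "\<dots> = upper_01 c"
      using 3 q0 t0 by (simp add: upper_01_def upper_12_def \<beta>_Suc \<theta>_def field_simps power2_eq_square)
    finally show ?thesis using 3 rc by (simp add: x01_def tri_def)
  next
    case 4
    then show ?thesis using rc unfolding S_mat_def x01_def tri_def by auto
  qed
qed (simp_all add: S_mat_def x01_def)

section \<open>Spectra of the generators\<close>

lemma \<beta>_inj: "\<beta> i = \<beta> j \<longleftrightarrow> i = j"
proof -
  have "\<beta> i \<noteq> \<beta> j" if "i < j" for i j
  proof
    assume "\<beta> i = \<beta> j"
    moreover have "\<beta> j = \<beta> i * q ^ (2 * (j - i))"
      using that by (simp add: \<beta>_def diff_mult_distrib2 flip: power_add)
    ultimately have "q ^ (2 * (j - i)) = 1" by simp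
    then show False using q_not_root[of "2 * (j - i)"] that by simp
  qed
  then show ?thesis by (metis nat_neq_iff)
qed

lemma q_diff_nonzero: "q - inverse q \<noteq> 0"
proof
  assume "q - inverse q = 0"
  then have "q * q = 1" using q0 by (simp add: field_simps)
  then show False using q_not_root[of 2] by (simp add: power2_eq_square)
qed

lemma \<theta>_nonzero: "\<theta> i \<noteq> 0" by (simp add: \<theta>_def)

lemma \<theta>_inj: "inj_on \<theta> S" by (rule inj_onI) (simp add: \<theta>_def \<beta>_inj)

lemma inverse_\<theta>_inj: "inj_on (\<lambda>i. inverse (\<theta> i)) S" by (rule inj_onI) (simp add: \<theta>_def \<beta>_inj)

lemma simple_spectrum_tri_upper:
  assumes "inj_on m {..<d + 1}"
  shows "simple_spectrum (d + 1) (tri d (\<lambda>_. 0) m u) m"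
proof -
  let ?M = "tri d (\<lambda>_. 0) m u"
  have m: "?M $$ (i, i) = m i" if "i < d + 1" for i using that by (simp add: tri_def)
  have "simple_spectrum (d + 1) ?M (\<lambda>i. ?M $$ (i, i))"
  proof (rule simple_spectrum_upper_triangular)
    show "upper_triangular ?M" by (rule upper_triangularI) (simp add: tri_def)
    show "inj_on (\<lambda>i. ?M $$ (i, i)) {..<d + 1}" using assms m by (auto simp: inj_on_def)
  qed simp
  then show ?thesis using simple_spectrum_cong[OF m] by simp
qed

lemma simple_spectrum_tri_lower:
  assumes "inj_on m {..<d + 1}"
  shows "simple_spectrum (d + 1) (tri d l m (\<lambda>_. 0)) m"
proof -
  let ?M = "tri d l m (\<lambda>_. 0)"
  have m: "?M $$ (i, i) = m i" if "i < d + 1" for i using that by (simp add: tri_def)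
  have "simple_spectrum (d + 1) ?M (\<lambda>i. ?M $$ (i, i))"
  proof (rule simple_spectrum_lower_triangular)
    show "inj_on (\<lambda>i. ?M $$ (i, i)) {..<d + 1}" using assms m by (auto simp: inj_on_def)
  qed (simp_all add: tri_def)
  then show ?thesis using simple_spectrum_cong[OF m] by simp
qed

lemma spectrum_12: "simple_spectrum (d + 1) x12 \<theta>" and spectrum_02: "simple_spectrum (d + 1) x02 \<theta>"
  and spectrum_31: "simple_spectrum (d + 1) x31 \<theta>" and spectrum_30: "simple_spectrum (d + 1) x30 \<theta>"
  and spectrum_23: "simple_spectrum (d + 1) x23 (\<lambda>i. inverse (\<theta> i))"
  using simple_spectrum_tri_upper[OF \<theta>_inj] simple_spectrum_tri_lower[OF \<theta>_inj]
    simple_spectrum_tri_upper[OF inverse_\<theta>_inj]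
  by (simp_all add: x12_def x02_def x31_def x30_def x23_def divide_inverse)

text \<open>Along the diagonal of \<open>x30\<close> the eigenvalues grow by the factor \<open>q\<^sup>2\<close>, so \<open>\<theta> j = q\<^sup>2 \<theta> i\<close> holds only
  for \<open>j = i + 1\<close>, which is above the diagonal.\<close>

lemma spectrum_01: "simple_spectrum (d + 1) x01 (\<lambda>i. inverse (\<theta> i))"
proof (rule simple_spectrum_raising[OF spectrum_30 x_carrier(4) q0 q_diff_nonzero \<theta>_nonzero])
  show "\<theta> j \<noteq> q\<^sup>2 * \<theta> i" if "j < i" for i j
  proof -
    have "\<beta> j \<noteq> \<beta> (Suc i)" using that by (simp add: \<beta>_inj)
    then show ?thesis by (simp add: \<theta>_def \<beta>_Suc power2_eq_square)
  qed
  show "q \<cdot>\<^sub>m (x30 * x01) - inverse q \<cdot>\<^sub>m (x01 * x30) = (q - inverse q) \<cdot>\<^sub>m 1\<^sub>m (d + 1)"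
    using qcomm_30_01 by (simp add: qcomm_def \<kappa>_def)
qed

definition "x13 = mat_inv d x31"
definition "x20 = mat_inv d x02"

lemma mat_inv:
  assumes "simple_spectrum (d + 1) M \<theta>"
  shows "mat_inv d M \<in> carrier_mat (d + 1) (d + 1)" "M * mat_inv d M = 1\<^sub>m (d + 1)" "mat_inv d M * M = 1\<^sub>m (d + 1)"
proof -
  have M: "M \<in> Units (ring_mat TYPE('f) (d + 1) ())"
    by (rule simple_spectrum_invertible[OF assms \<theta>_nonzero])
  have mon: "Group.monoid (ring_mat TYPE('f) (d + 1) ())" by (rule ring.is_monoid[OF ring_mat])
  show "mat_inv d M \<in> carrier_mat (d + 1) (d + 1)" "M * mat_inv d M = 1\<^sub>m (d + 1)" "mat_inv d M * M = 1\<^sub>m (d + 1)"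
    using monoid.Units_inv_closed[OF mon M] monoid.Units_r_inv[OF mon M] monoid.Units_l_inv[OF mon M]
    by (simp_all add: ring_mat_simps)
qed

lemmas inverse_31 = mat_inv[OF spectrum_31, folded x13_def]
lemmas inverse_02 = mat_inv[OF spectrum_02, folded x20_def]

lemma spectrum_13: "simple_spectrum (d + 1) x13 (\<lambda>i. inverse (\<theta> i))"
  by (rule simple_spectrum_inverse[OF spectrum_31 inverse_31(1,3) \<theta>_nonzero])
lemma spectrum_20: "simple_spectrum (d + 1) x20 (\<lambda>i. inverse (\<theta> i))"
  by (rule simple_spectrum_inverse[OF spectrum_02 inverse_02(1,3) \<theta>_nonzero])

section \<open>The module\<close>

text \<open>Only meaningful if \<open>j - i \<in> {1, 2}\<close>.\<close>

definition X :: "4 \<Rightarrow> 4 \<Rightarrow> 'f mat" where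
  "X i j =
     (if j - i = 1 then (if i = 0 then x01 else if i = 1 then x12 else if i = 2 then x23 else x30)
      else (if i = 0 then x02 else if i = 1 then x13 else if i = 2 then x20 else x31))"

lemma X_simps: "X 0 1 = x01" "X 1 2 = x12" "X 2 3 = x23" "X 3 0 = x30"
  "X 0 2 = x02" "X 1 3 = x13" "X 2 0 = x20" "X 3 1 = x31"
  by (simp_all add: X_def)

text \<open>Numerals up to 6 occur because the simplifier adds numerals without reduction modulo 4.\<close>

lemma shift_4: "(2::4) + 2 = 0" "(2::4) + 1 = 3" "(1::4) + 1 = 2" "(1::4) + 2 = 3" "(3::4) + 1 = 0" "(3::4) + 2 = 1"
  "(4::4) = 0" "(5::4) = 1" "(6::4) = 2"
  by simp_all

text \<open>The two commutator identities in the form that \<open>q_serre_of_commutator\<close> asks for: the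
  commutator of \<open>A\<close> with the opposite generator is a multiple of its predecessor minus its successor
  in the cycle \<open>x01, x12, x23, x30\<close>.\<close>

lemma commutators:
  "x01 * x23 - x23 * x01 = (- (\<kappa> / t)) \<cdot>\<^sub>m (x30 - x12)"
  "x12 * x30 - x30 * x12 = (- (t * \<kappa>)) \<cdot>\<^sub>m (x01 - x23)"
  "x23 * x01 - x01 * x23 = (- (\<kappa> / t)) \<cdot>\<^sub>m (x12 - x30)"
  "x30 * x12 - x12 * x30 = (- (t * \<kappa>)) \<cdot>\<^sub>m (x23 - x01)"
proof -
  have neg: "s \<cdot>\<^sub>m (M - N) = (- s) \<cdot>\<^sub>m (N - M)"
    if "M \<in> carrier_mat (d+1) (d+1)" "N \<in> carrier_mat (d+1) (d+1)" for M N and s :: 'f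
    using that by (intro eq_matI) (auto simp: algebra_simps)
  show "x01 * x23 - x23 * x01 = (- (\<kappa> / t)) \<cdot>\<^sub>m (x30 - x12)"
    unfolding commutator_01_23 by (rule neg[OF x_carrier(1,2)])
  show "x30 * x12 - x12 * x30 = (- (t * \<kappa>)) \<cdot>\<^sub>m (x23 - x01)"
    unfolding commutator_30_12 by (rule neg[OF x_carrier(4,3)])
  show "x12 * x30 - x30 * x12 = (- (t * \<kappa>)) \<cdot>\<^sub>m (x01 - x23)"
    by (rule commutator_swap[OF x_carrier(2,1) commutator_30_12])
  show "x23 * x01 - x01 * x23 = (- (\<kappa> / t)) \<cdot>\<^sub>m (x12 - x30)"
    by (rule commutator_swap[OF x_carrier(4,3) commutator_01_23])
qed

sublocale tet_matrices "d + 1" q X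
proof
  show "X i j \<in> carrier_mat (d + 1) (d + 1)" for i j
    using x_carrier inverse_31(1) inverse_02(1) by (simp add: X_def)
  show "q - inverse q \<noteq> 0" by (rule q_diff_nonzero)
  note S = X_simps shift_4
  show "X i j * X j i = 1\<^sub>m (d + 1)" if "j - i = 2" for i j :: 4
  proof -
    have j: "j = i + 2" using that by (simp add: algebra_simps)
    show ?thesis using exhaust_4[of i] inverse_31 inverse_02 by (auto simp: j S)
  qed
  show "qcomm q (X i j) (X j k) = (q - inverse q) \<cdot>\<^sub>m 1\<^sub>m (d + 1)"
    if ijk: "(j - i, k - j) \<in> {(1, 1), (1, 2), (2, 1)}" for i j k :: 4
  proof -
    note R = qcomm_01_12 qcomm_12_23 qcomm_23_30 qcomm_30_01 qcomm_23_31 qcomm_30_02 qcomm_02_23 qcomm_31_12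
      qcomm_inverse(1)[OF x_carrier(5) inverse_31(1) x_carrier(4) inverse_31(2,3) qcomm_31_01]
      qcomm_inverse(1)[OF x_carrier(6) inverse_02(1) x_carrier(1) inverse_02(2,3) qcomm_02_12]
      qcomm_inverse(2)[OF x_carrier(5) inverse_31(1) x_carrier(2) inverse_31(2,3) qcomm_30_31]
      qcomm_inverse(2)[OF x_carrier(6) inverse_02(1) x_carrier(4) inverse_02(2,3) qcomm_01_02]
    consider "j = i + 1" "k = j + 1" | "j = i + 1" "k = j + 2" | "j = i + 2" "k = j + 1"
    proof -
      have "b - a = c \<Longrightarrow> b = a + c" for a b c :: 4 by (simp add: algebra_simps)
      then show ?thesis using ijk that by blast
    qed
    then show ?thesis
      using exhaust_4[of i] R by cases (auto simp: S \<kappa>_def)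
  qed
  show "X i j * X i j * X i j * X k l
      - q_number 3 q \<cdot>\<^sub>m (X i j * X i j * X k l * X i j)
      + q_number 3 q \<cdot>\<^sub>m (X i j * X k l * X i j * X i j)
      - X k l * X i j * X i j * X i j = 0\<^sub>m (d + 1) (d + 1)"
    if "j - i = 1" "k - j = 1" "l - k = 1" for i j k l :: 4
  proof -
    have jkl: "j = i + 1" "k = j + 1" "l = k + 1" using that by (auto simp: algebra_simps)
    note serre = q_serre_of_commutator[where n = "d + 1" and q = q, OF _ _ _ _ q0 q_diff_nonzero]
    note R = qcomm_01_12 qcomm_12_23 qcomm_23_30 qcomm_30_01
    note R' = R[unfolded qcomm_def \<kappa>_def]
    show ?thesis
      using exhaust_4[of i] serre[OF x_carrier(4,3,1,2) commutators(1) R'(1,4)]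
        serre[OF x_carrier(1,2,3,4) commutators(2) R'(2,1)]
        serre[OF x_carrier(3,4,2,1) commutators(3) R'(3,2)]
        serre[OF x_carrier(2,1,4,3) commutators(4) R'(4,3)]
      by (auto simp: jkl S)
  qed
qed

abbreviation "V \<equiv> module_vec TYPE('f) (d + 1)"

lemma spectrum_set:
  "\<theta> ` {..<d + 1} = {q powi (int d - 2 * int n) | n. n \<le> d}"
  "(\<lambda>i. inverse (\<theta> i)) ` {..<d + 1} = {q powi (int d - 2 * int n) | n. n \<le> d}"
proof -
  have 1: "\<theta> i = q powi (int d - 2 * int (d - i))" if "i \<le> d" for i
    by (subst powi_\<theta>[of _ i 0]) (use that in simp_all)
  have 2: "inverse (\<theta> i) = q powi (int d - 2 * int i)" for i
    by (subst powi_inverse_\<theta>[of _ i 0]) (simp_all add: divide_inverse)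
  show "\<theta> ` {..<d + 1} = {q powi (int d - 2 * int n) | n. n \<le> d}"
  proof (intro equalityI subsetI)
    fix x assume "x \<in> \<theta> ` {..<d + 1}"
    then obtain i where "i < d + 1" "x = \<theta> i" by blast
    then have "x = q powi (int d - 2 * int (d - i)) \<and> d - i \<le> d" using 1 by simp
    then show "x \<in> {q powi (int d - 2 * int n) | n. n \<le> d}" by blast
  next
    fix x assume "x \<in> {q powi (int d - 2 * int n) | n. n \<le> d}"
    then obtain n where n: "n \<le> d" "x = q powi (int d - 2 * int n)" by blast
    then have "x = \<theta> (d - n)" using 1[of "d - n"] by simp
    then show "x \<in> \<theta> ` {..<d + 1}" by auto
  qed
  show "(\<lambda>i. inverse (\<theta> i)) ` {..<d + 1} = {q powi (int d - 2 * int n) | n. n \<le> d}"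
    unfolding 2 by auto
qed

lemma X_spectrum:
  assumes "j - i = 1 \<or> j - i = (2::4)"
  shows "\<exists>\<mu>. simple_spectrum (d + 1) (X i j) \<mu> \<and> \<mu> ` {..<d + 1} = {q powi (int d - 2 * int n) | n. n \<le> d}"
proof -
  have "simple_spectrum (d + 1) (X i j) \<theta> \<or> simple_spectrum (d + 1) (X i j) (\<lambda>i. inverse (\<theta> i))"
    using exhaust_4[of i] assms spectrum_12 spectrum_30 spectrum_23 spectrum_01 spectrum_31 spectrum_02 spectrum_13 spectrum_20
    by (auto simp: X_def)
  then show ?thesis using spectrum_set by blast
qed

lemma diameter: "has_diameter_and_type q V act d 1"
  unfolding has_diameter_and_type_def
proof (intro conjI allI impI)
  fix i j :: 4 assume ij: "j - i = 1 \<or> j - i = 2"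
  obtain \<mu> where \<mu>: "simple_spectrum (d + 1) (X i j) \<mu>" "\<mu> ` {..<d + 1} = {q powi (int d - 2 * int n) | n. n \<le> d}"
    using X_spectrum[OF ij] by blast
  show "lin_diagonalizable V (act (tet_x q i j))"
    by (rule simple_spectrum_diagonalizable[OF \<mu>(1) act_tet_x[OF ij]])
  show "lin_eigenvalues V (act (tet_x q i j)) = {1 * q powi (int d - 2 * int n) |n. n \<le> d}"
    unfolding simple_spectrum_eigenvalues[OF \<mu>(1) act_tet_x[OF ij]] \<mu>(2) by simp
qed simp

lemma shape: "has_shape q V act (replicate (d + 1) 1)"
  unfolding has_shape_def
proof (intro exI[of _ d] conjI allI impI diameter)
  fix i j :: 4 and n assume ij: "j - i = 1 \<or> j - i = 2" and n: "n \<le> d"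
  obtain \<mu> where \<mu>: "simple_spectrum (d + 1) (X i j) \<mu>" "\<mu> ` {..<d + 1} = {q powi (int d - 2 * int n) | n. n \<le> d}"
    using X_spectrum[OF ij] by blast
  have "q powi (int d - 2 * int n) \<in> \<mu> ` {..<d + 1}" unfolding \<mu>(2) using n by blast
  then obtain m where m: "m < d + 1" "q powi (int d - 2 * int n) = \<mu> m" by blast
  show "vectorspace.dim class_ring (V\<lparr>carrier := lin_eigenspace V (act (tet_x q i j)) (q powi (int d - 2 * int n))\<rparr>)
      = replicate (d + 1) 1 ! n"
    using simple_spectrum_dim_eigenspace[OF \<mu>(1) act_tet_x[OF ij] m(1)] n by (simp add: m(2) del: replicate.simps)
qed simp

lemma mat_diag_x23: "mat_diag (d + 1) (\<lambda>i. 1 / \<theta> i) = x23"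
  by (rule eq_matI) (auto simp: mat_diag_def x23_def tri_def)

text \<open>By the diagonal matrix \<open>x23\<close> a nonzero submodule contains some unit vector \<open>e\<^sub>i\<close>. Since
  \<open>x31 e\<^sub>j = \<theta> j e\<^sub>j + lower_31 (j + 1) e\<^sub>j\<^sub>+\<^sub>1\<close> and \<open>x12 e\<^sub>j\<^sub>+\<^sub>1 = \<theta> (j + 1) e\<^sub>j\<^sub>+\<^sub>1 + upper_12 (j + 1) e\<^sub>j\<close>
  with nonzero coefficients, it contains the neighbours of each of its unit vectors.\<close>

lemma irreducible: "irreducible_module (tet_algebra q) V act"
  unfolding irreducible_module_def
proof (intro conjI allI impI)
  interpret VS: vec_space "TYPE('f)" "d + 1" .
  have "unit_vec (d + 1) 0 \<noteq> (0\<^sub>v (d + 1) :: 'f vec)"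
    by (metis index_unit_vec(1) index_zero_vec(1) one_neq_zero zero_less_Suc Suc_eq_plus1)
  then show "carrier V \<noteq> {\<zero>\<^bsub>V\<^esub>}"
    unfolding module_vec_simps using unit_vec_carrier[of "d + 1" 0] by blast
  fix W assume "VectorSpace.subspace class_ring W V \<and> (\<forall>a\<in>carrier (tet_algebra q). act a ` W \<subseteq> W)"
  then have sub: "submodule class_ring W V" and inv: "\<And>a. a \<in> carrier (tet_algebra q) \<Longrightarrow> act a ` W \<subseteq> W"
    by (auto simp: VectorSpace.subspace_def)
  have Wc: "W \<subseteq> carrier_vec (d + 1)" using submodule.subset[OF sub] by (simp add: module_vec_simps)
  have zero: "0\<^sub>v (d + 1) \<in> W" using submodule.zero_closed[OF sub] by (simp add: module_vec_simps)
  have smult: "c \<cdot>\<^sub>v x \<in> W" if "x \<in> W" for c x using submodule.smult_closed[OF sub _ that, of c] by (simp add: module_vec_simps)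
  have add: "x + y \<in> W" if "x \<in> W" "y \<in> W" for x y using submodule.m_closed[OF sub that] by (simp add: module_vec_simps)
  have minus: "x - y \<in> W" if "x \<in> W" "y \<in> W" for x y
  proof -
    have "x - y = x + (-1) \<cdot>\<^sub>v y" using that Wc by (intro eq_vecI) auto
    then show ?thesis using add[OF that(1) smult[OF that(2)]] by simp
  qed
  have X: "X i j *\<^sub>v x \<in> W" if "j - i = 1 \<or> j - i = 2" "x \<in> W" for i j x
    using inv[OF tet_x_carrier[of i j]] act_tet_x[OF that(1), of x] that(2) by auto
  have A: "x12 *\<^sub>v x \<in> W" and C: "x23 *\<^sub>v x \<in> W" and F: "x31 *\<^sub>v x \<in> W" if "x \<in> W" for x
    using X[of 2 1 x] X[of 3 2 x] X[of 1 3 x] that by (simp_all add: X_simps)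
  show "W = {\<zero>\<^bsub>V\<^esub>} \<or> W = carrier V"
  proof (cases "W = {\<zero>\<^bsub>V\<^esub>}")
    case False
    then obtain v where v: "v \<in> W" "v \<noteq> 0\<^sub>v (d + 1)" using zero by (auto simp: module_vec_simps)
    have "\<exists>i<d + 1. unit_vec (d + 1) i \<in> W"
      by (rule diag_invariant_contains_unit_vec[where \<mu> = "\<lambda>i. 1 / \<theta> i", OF Wc minus smult _ _ v])
        (simp_all only: mat_diag_x23 C, simp_all add: inverse_\<theta>_inj divide_inverse)
    then obtain i where "i < d + 1" and i: "unit_vec (d + 1) i \<in> W" by blast
    then have "i \<le> d" by simp
    have up: "unit_vec (d + 1) (Suc j) \<in> W" if j: "unit_vec (d + 1) j \<in> W" "j < d" for j
    proof -
      have nz: "lower_31 (Suc j) \<noteq> 0" using \<beta>_inj[of "Suc j" 0] by (simp add: lower_31_def \<beta>_0)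
      have "inverse (lower_31 (Suc j)) \<cdot>\<^sub>v (x31 *\<^sub>v unit_vec (d + 1) j - \<theta> j \<cdot>\<^sub>v unit_vec (d + 1) j) \<in> W"
        by (intro smult minus F j)
      also have "inverse (lower_31 (Suc j)) \<cdot>\<^sub>v (x31 *\<^sub>v unit_vec (d + 1) j - \<theta> j \<cdot>\<^sub>v unit_vec (d + 1) j) = unit_vec (d + 1) (Suc j)"
      proof -
        have "x31 *\<^sub>v unit_vec (d + 1) j = col x31 j" using j(2) by (intro mult_unit_vec[OF x_carrier(5)]) simp
        then show ?thesis using j(2) nz by (intro eq_vecI) (auto simp: x31_def tri_def unit_vec_def)
      qed
      finally show ?thesis .
    qed
    have down: "unit_vec (d + 1) j \<in> W" if j: "unit_vec (d + 1) (Suc j) \<in> W" "j < d" for j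
    proof -
      have "\<alpha> * \<alpha> \<noteq> \<beta> j" using \<beta>_inj[of d j] j(2) by (simp add: \<beta>_d)
      then have nz: "upper_12 (Suc j) \<noteq> 0" using q0 by (simp add: upper_12_def \<beta>_Suc power2_eq_square field_simps)
      have "inverse (upper_12 (Suc j)) \<cdot>\<^sub>v (x12 *\<^sub>v unit_vec (d + 1) (Suc j) - \<theta> (Suc j) \<cdot>\<^sub>v unit_vec (d + 1) (Suc j)) \<in> W"
        by (intro smult minus A j)
      also have "inverse (upper_12 (Suc j)) \<cdot>\<^sub>v (x12 *\<^sub>v unit_vec (d + 1) (Suc j) - \<theta> (Suc j) \<cdot>\<^sub>v unit_vec (d + 1) (Suc j)) = unit_vec (d + 1) j"
      proof -
        have "x12 *\<^sub>v unit_vec (d + 1) (Suc j) = col x12 (Suc j)" using j(2) by (intro mult_unit_vec[OF x_carrier(1)]) simp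
        then show ?thesis using j(2) nz by (intro eq_vecI) (auto simp: x12_def tri_def unit_vec_def)
      qed
      finally show ?thesis .
    qed
    have "unit_vec (d + 1) 0 \<in> W"
      using \<open>i \<le> d\<close> i by (induction i) (use down in auto)
    then have "unit_vec (d + 1) j \<in> W" if "j \<le> d" for j
      using that by (induction j) (use up in auto)
    then have "set (unit_vecs (d + 1)) \<subseteq> W" by (auto simp: unit_vecs_def)
    then have "VS.span (set (unit_vecs (d + 1))) \<subseteq> W" using sub by (rule VS.span_is_subset)
    then show ?thesis using Wc VS.span_unit_vecs_is_carrier by (auto simp: module_vec_simps)
  qed simp
qed

lemma evaluation_module_act: "evaluation_module q V act"
proof -
  interpret VS: vec_space "TYPE('f)" "d + 1" .
  have "\<not> trivial_tet_module q V act" using VS.dim_is_n d1 by (simp add: trivial_tet_module_def)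
  moreover have "fin_dim_irreducible_tet_module q V act"
    unfolding fin_dim_irreducible_tet_module_def using algebra_module_act irreducible VS.fin_dim by blast
  ultimately show ?thesis unfolding evaluation_module_def using diameter shape by blast
qed

lemma represents_act:
  assumes "j - i = 1 \<or> j - i = 2"
  shows "represents d V (unit_vec (d + 1)) (X i j) (act (tet_x q i j))"
  by (rule represents_unit_vec[OF X_carrier act_tet_x[OF assms]])

end

theorem proposition9p2:
  fixes q t :: "'f::alg_closed_field" and d :: nat
  assumes "q \<noteq> 0"
    and "\<And>n. n > 0 \<Longrightarrow> q ^ n \<noteq> 1"
    and "d \<ge> 1"
    and "t \<noteq> 0"
    and "t \<notin> {q powi (int d - 2 * int n + 1) | n. n \<in> {1..d}}"
  shows "\<exists>(V :: ('f, 'f vec) module) \<rho>.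
    evaluation_module q V \<rho> \<and>
    (\<exists>v. indexed_basis d V v \<and>
      represents d V v (Z_mat d * S_mat d (inverse q) (inverse t) * Z_mat d) (\<rho> (tet_x q 0 1)) \<and>
      represents d V v (E_mat d q) (\<rho> (tet_x q 1 2)) \<and>
      represents d V v (K_mat d q) (\<rho> (tet_x q 2 3)) \<and>
      represents d V v (Z_mat d * G_mat d (inverse q) t * Z_mat d) (\<rho> (tet_x q 3 0)) \<and>
      represents d V v (L_mat d q t) (\<rho> (tet_x q 0 2)) \<and>
      represents d V v (mat_inv d (Z_mat d * E_mat d (inverse q) * Z_mat d)) (\<rho> (tet_x q 1 3)) \<and>
      represents d V v (mat_inv d (L_mat d q t)) (\<rho> (tet_x q 2 0)) \<and>
      represents d V v (Z_mat d * E_mat d (inverse q) * Z_mat d) (\<rho> (tet_x q 3 1)))"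
proof -
  interpret evaluation_matrices q t d
    using assms by unfold_locales blast+
  have "indexed_basis d V (unit_vec (d + 1))" by (rule indexed_basis_unit_vec)
  moreover note represents_act[of 1 0] represents_act[of 2 1] represents_act[of 3 2] represents_act[of 0 3]
    represents_act[of 2 0] represents_act[of 3 1] represents_act[of 0 2] represents_act[of 1 3]
  ultimately show ?thesis
    unfolding E_mat_eq K_mat_eq L_mat_eq ZEZ_eq ZGZ_eq ZSZ_eq x13_def[symmetric] x20_def[symmetric]
    using evaluation_module_act by (intro exI[of _ V] exI[of _ act] conjI exI[of _ "unit_vec (d + 1)"]) (simp_all add: X_simps)
qed

end
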